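(* Let $n\ge 2$. Every regular dihedral $\mathrm{ETF}(2n,n)$ $\Phi$ is genuine projective. Furthermore, there exists a skew Hadamard matrix $H=[P,Q;-Q^\top,P^\top]$ with negacirculant $n\times n$ matrices $P,Q$ for which, up to switching equivalence, $$\Phi^*\Phi=I_{2n}+\frac{1}{\sqrt{2n-1}}\begin{bmatrix}\mathrm{i}(P-I_n) & Q\\ Q^\top & \mathrm{i}(-P+I_n)\end{bmatrix}.$$
   Context: $D_n$ is generated by $\mu,\tau$ with $\mu^n=\tau^2=1$, $\tau\mu=\mu^{-1}\tau$. A dihedral configuration is $(\pi(g)v)_{g\in D_n}$ for a unit vector $v\in\mathbb{C}^n$ and a projective unitary representation $\pi:D_n\to U(n)$ ($\pi(gg')$ equals $\pi(g)\pi(g')$ up to a unimodular scalar); it is genuine projective if $\pi$ is not equivalent (via conjugation by a unitary, up to unimodular scalars) to a strict representation (a homomorphism); it is regular if $v,\pi(\mu)v,\dots,\pi(\mu^{n-1})v$ is a basis of $\mathbb{C}^n$. An $\mathrm{ETF}(2n,n)$: $2n$ unit vectors in $\mathbb{C}^n$ forming a tight frame with constant $|\langle\varphi_i,\varphi_j\rangle|$, $i\neq j$. "Up to switching equivalence" means $\Pi\Phi^*\Phi\Pi^*$ equals the displayed matrix for some phase monomial $\Pi$. Skew Hadamard: $\pm1$ matrix $H$ of order $m$ with $HH^\top=mI$, $H+H^\top=2I$. Negacirculant: entries $w_{j-i}$ for $j\ge i$ and $-w_{n+j-i}$ for $j<i$. *)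

theory Defs
  imports
    "HOL-Algebra.Generated_Groups"
    "HOL-Combinatorics.Permutations"
    "Jordan_Normal_Form.Schur_Decomposition"
begin

section \<open>The dihedral group\<close>

text \<open>
  The pair \<open>(k, e)\<close> with \<open>k < n\<close> stands for \<open>\<mu>\<^sup>k \<tau>\<close> if \<open>e\<close> holds and for \<open>\<mu>\<^sup>k\<close> otherwise;
  the multiplication is the one forced by \<open>\<tau> \<mu> = \<mu>\<^sup>-\<^sup>1 \<tau>\<close>.
\<close>

definition dihedral_group :: "nat \<Rightarrow> (nat \<times> bool) monoid" where
  "dihedral_group n = \<lparr>carrier = {0..<n} \<times> UNIV,
     monoid.mult = (\<lambda>(a, e) (b, f). ((a + (if e then n - b else b)) mod n, e \<noteq> f)),
     one = (0, False)\<rparr>"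

definition dih_mu :: "nat \<Rightarrow> nat \<times> bool" where
  "dih_mu n = (1 mod n, False)"

definition dih_tau :: "nat \<times> bool" where
  "dih_tau = (0, True)"

lemma group_dihedral_group:
  assumes "n > 0"
  shows "group (dihedral_group n)"
proof (rule groupI)
  fix x y assume "x \<in> carrier (dihedral_group n)" "y \<in> carrier (dihedral_group n)"
  then show "x \<otimes>\<^bsub>dihedral_group n\<^esub> y \<in> carrier (dihedral_group n)"
    using assms by (cases x; cases y) (auto simp: dihedral_group_def)
next
  show "\<one>\<^bsub>dihedral_group n\<^esub> \<in> carrier (dihedral_group n)"
    using assms by (auto simp: dihedral_group_def)
next
  fix x y z
  assume "x \<in> carrier (dihedral_group n)" "y \<in> carrier (dihedral_group n)"
    "z \<in> carrier (dihedral_group n)"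
  then obtain a e b f c g where xyz: "x = (a, e)" "y = (b, f)" "z = (c, g)"
    and lt: "a < n" "b < n" "c < n"
    by (cases x; cases y; cases z) (auto simp: dihedral_group_def)
  let ?m = "\<lambda>e b. if e then n - b else b"
  have bound: "(a + ?m e b) mod n < n" for a b e
    using assms by simp
  have cong2: "int ((a + ?m e b) mod n) mod int n = (int a + (if e then - int b else int b)) mod int n"
    if "b < n" for a b e
  proof -
    have "(int a + int n - int b) mod int n = (int a - int b) mod int n"
      using mod_add_self2[of "int a - int b" "int n"] by (simp add: algebra_simps)
    then show ?thesis
      using that assms by (cases e) (simp_all add: zmod_int of_nat_diff less_imp_le)
  qed
  have "int (((a + ?m e b) mod n + ?m (e \<noteq> f) c) mod n) mod int n
      = int ((a + ?m e ((b + ?m f c) mod n)) mod n) mod int n"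
  proof -
    have "int (((a + ?m e b) mod n + ?m (e \<noteq> f) c) mod n) mod int n
        = (int ((a + ?m e b) mod n) + (if e \<noteq> f then - int c else int c)) mod int n"
      by (rule cong2[OF lt(3)])
    also have "\<dots> = (int a + (if e then - int b else int b)
        + (if e \<noteq> f then - int c else int c)) mod int n"
      by (rule mod_add_cong[OF cong2[OF lt(2)] refl])
    also have "\<dots> = (int a + (if e then - (int b + (if f then - int c else int c))
        else int b + (if f then - int c else int c))) mod int n"
      by (cases e; cases f) (simp_all add: algebra_simps)
    also have "\<dots> = (int a + (if e then - int ((b + ?m f c) mod n)
        else int ((b + ?m f c) mod n))) mod int n"
    proof (cases e)
      case True
      show ?thesis unfolding if_P[OF True]
        by (rule mod_add_cong[OF refl mod_minus_cong[OF cong2[OF lt(3), symmetric]]])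
    next
      case False
      show ?thesis unfolding if_not_P[OF False]
        by (rule mod_add_cong[OF refl cong2[OF lt(3), symmetric]])
    qed
    also have "\<dots> = int ((a + ?m e ((b + ?m f c) mod n)) mod n) mod int n"
      by (rule cong2[symmetric]) (rule bound)
    finally show ?thesis .
  qed
  then have "((a + ?m e b) mod n + ?m (e \<noteq> f) c) mod n
      = (a + ?m e ((b + ?m f c) mod n)) mod n"
    by (simp flip: zmod_int)
  then show "x \<otimes>\<^bsub>dihedral_group n\<^esub> y \<otimes>\<^bsub>dihedral_group n\<^esub> z
      = x \<otimes>\<^bsub>dihedral_group n\<^esub> (y \<otimes>\<^bsub>dihedral_group n\<^esub> z)"
    by (cases e; cases f; cases g) (simp_all add: dihedral_group_def xyz)
next
  fix x assume "x \<in> carrier (dihedral_group n)"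
  then show "\<one>\<^bsub>dihedral_group n\<^esub> \<otimes>\<^bsub>dihedral_group n\<^esub> x = x"
    by (cases x) (auto simp: dihedral_group_def)
next
  fix x assume x: "x \<in> carrier (dihedral_group n)"
  obtain a e where "x = (a, e)" by (cases x)
  then show "\<exists>y\<in>carrier (dihedral_group n). y \<otimes>\<^bsub>dihedral_group n\<^esub> x = \<one>\<^bsub>dihedral_group n\<^esub>"
    using x assms
    by (intro bexI[of _ "(if e then a else (n - a) mod n, e)"])
      (auto simp: dihedral_group_def mod_simps)
qed

lemma dih_mu_pow:
  "k < n \<Longrightarrow> dih_mu n [^]\<^bsub>dihedral_group n\<^esub> k = (k, False)"
  by (induction k) (simp_all add: nat_pow_def dih_mu_def dihedral_group_def mod_simps)

lemma dihedral_element_eq: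
  "k < n \<Longrightarrow> (k, True) = dih_mu n [^]\<^bsub>dihedral_group n\<^esub> k \<otimes>\<^bsub>dihedral_group n\<^esub> dih_tau"
  by (simp add: dih_mu_pow) (simp add: dihedral_group_def dih_tau_def)

lemma dihedral_relations:
  assumes "n > 0"
  shows "dih_mu n [^]\<^bsub>dihedral_group n\<^esub> n = \<one>\<^bsub>dihedral_group n\<^esub>"
    and "dih_tau [^]\<^bsub>dihedral_group n\<^esub> (2::nat) = \<one>\<^bsub>dihedral_group n\<^esub>"
    and "dih_tau \<otimes>\<^bsub>dihedral_group n\<^esub> dih_mu n
      = inv\<^bsub>dihedral_group n\<^esub> (dih_mu n) \<otimes>\<^bsub>dihedral_group n\<^esub> dih_tau"
proof -
  interpret G: group "dihedral_group n" by (rule group_dihedral_group[OF assms])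
  obtain m where m: "n = Suc m" using assms by (cases n) auto
  have mu: "dih_mu n \<in> carrier (dihedral_group n)"
    using assms by (simp add: dih_mu_def dihedral_group_def)
  have "dih_mu n [^]\<^bsub>dihedral_group n\<^esub> Suc m
      = dih_mu n [^]\<^bsub>dihedral_group n\<^esub> m \<otimes>\<^bsub>dihedral_group n\<^esub> dih_mu n"
    by (rule G.nat_pow_Suc)
  also have "\<dots> = (m, False) \<otimes>\<^bsub>dihedral_group n\<^esub> dih_mu n"
    using dih_mu_pow[of m n] m by simp
  also have "\<dots> = \<one>\<^bsub>dihedral_group n\<^esub>"
    using m by (cases m) (simp_all add: dihedral_group_def dih_mu_def)
  finally show "dih_mu n [^]\<^bsub>dihedral_group n\<^esub> n = \<one>\<^bsub>dihedral_group n\<^esub>" using m by simp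
  show "dih_tau [^]\<^bsub>dihedral_group n\<^esub> (2::nat) = \<one>\<^bsub>dihedral_group n\<^esub>"
    by (simp add: numeral_2_eq_2) (simp add: dihedral_group_def dih_tau_def)
  have "inv\<^bsub>dihedral_group n\<^esub> (dih_mu n) = ((n - 1) mod n, False)"
    using mu m by (intro G.inv_equality)
      (cases m; simp add: dihedral_group_def dih_mu_def)+
  then show "dih_tau \<otimes>\<^bsub>dihedral_group n\<^esub> dih_mu n
      = inv\<^bsub>dihedral_group n\<^esub> (dih_mu n) \<otimes>\<^bsub>dihedral_group n\<^esub> dih_tau"
    using m by (cases m) (simp_all add: dihedral_group_def dih_mu_def dih_tau_def)
qed

lemma dihedral_generated:
  assumes "n > 0"
  shows "generate (dihedral_group n) {dih_mu n, dih_tau} = carrier (dihedral_group n)"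
proof -
  interpret G: group "dihedral_group n" by (rule group_dihedral_group[OF assms])
  have sub: "{dih_mu n, dih_tau} \<subseteq> carrier (dihedral_group n)"
    using assms by (simp add: dih_mu_def dih_tau_def dihedral_group_def)
  interpret S: subgroup "generate (dihedral_group n) {dih_mu n, dih_tau}" "dihedral_group n"
    by (rule G.generate_is_subgroup[OF sub])
  have gen: "dih_mu n \<in> generate (dihedral_group n) {dih_mu n, dih_tau}"
    "dih_tau \<in> generate (dihedral_group n) {dih_mu n, dih_tau}"
    by (auto intro: generate.incl)
  have pow: "dih_mu n [^]\<^bsub>dihedral_group n\<^esub> k \<in> generate (dihedral_group n) {dih_mu n, dih_tau}"
    for k :: nat
    by (induction k) (auto intro: S.m_closed gen)
  have "x \<in> generate (dihedral_group n) {dih_mu n, dih_tau}"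
    if "x \<in> carrier (dihedral_group n)" for x
  proof -
    obtain k e where x: "x = (k, e)" by (cases x)
    moreover have "k < n" using that by (simp add: x dihedral_group_def)
    ultimately show ?thesis
      using pow[of k] S.m_closed[OF pow[of k] gen(2)]
      by (cases e) (simp_all add: dih_mu_pow dihedral_element_eq)
  qed
  then show ?thesis using G.generate_incl[OF sub] by blast
qed

section \<open>Projective unitary representations\<close>

definition unitary_mat :: "nat \<Rightarrow> complex mat \<Rightarrow> bool" where
  "unitary_mat d U \<longleftrightarrow>
     U \<in> carrier_mat d d \<and> mat_adjoint U * U = 1\<^sub>m d \<and> U * mat_adjoint U = 1\<^sub>m d"

definition proj_unitary_rep :: "('g, 'm) monoid_scheme \<Rightarrow> nat \<Rightarrow> ('g \<Rightarrow> complex mat) \<Rightarrow> bool" where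
  "proj_unitary_rep G d \<pi> \<longleftrightarrow>
     (\<forall>g\<in>carrier G. unitary_mat d (\<pi> g)) \<and>
     (\<forall>g\<in>carrier G. \<forall>h\<in>carrier G. \<exists>c. cmod c = 1 \<and> \<pi> (g \<otimes>\<^bsub>G\<^esub> h) = c \<cdot>\<^sub>m (\<pi> g * \<pi> h))"

definition strict_unitary_rep :: "('g, 'm) monoid_scheme \<Rightarrow> nat \<Rightarrow> ('g \<Rightarrow> complex mat) \<Rightarrow> bool" where
  "strict_unitary_rep G d \<rho> \<longleftrightarrow>
     (\<forall>g\<in>carrier G. unitary_mat d (\<rho> g)) \<and>
     (\<forall>g\<in>carrier G. \<forall>h\<in>carrier G. \<rho> (g \<otimes>\<^bsub>G\<^esub> h) = \<rho> g * \<rho> h)"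

definition proj_equivalent ::
  "('g, 'm) monoid_scheme \<Rightarrow> nat \<Rightarrow> ('g \<Rightarrow> complex mat) \<Rightarrow> ('g \<Rightarrow> complex mat) \<Rightarrow> bool" where
  "proj_equivalent G d \<pi> \<rho> \<longleftrightarrow>
     (\<exists>U. unitary_mat d U \<and>
        (\<forall>g\<in>carrier G. \<exists>c. cmod c = 1 \<and> \<rho> g = c \<cdot>\<^sub>m (U * \<pi> g * mat_adjoint U)))"

definition genuine_projective :: "('g, 'm) monoid_scheme \<Rightarrow> nat \<Rightarrow> ('g \<Rightarrow> complex mat) \<Rightarrow> bool" where
  "genuine_projective G d \<pi> \<longleftrightarrow>
     proj_unitary_rep G d \<pi> \<and> \<not> (\<exists>\<rho>. strict_unitary_rep G d \<rho> \<and> proj_equivalent G d \<pi> \<rho>)"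

section \<open>Frames and dihedral configurations\<close>

text \<open>A finite sequence of vectors is identified with the matrix having these vectors as columns.\<close>

definition tight_frame :: "nat \<Rightarrow> nat \<Rightarrow> complex mat \<Rightarrow> bool" where
  "tight_frame m d \<Phi> \<longleftrightarrow> \<Phi> \<in> carrier_mat d m \<and>
     (\<exists>A>0. \<forall>x\<in>carrier_vec d. (\<Sum>i<m. (cmod (x \<bullet>c col \<Phi> i))\<^sup>2) = A * Re (x \<bullet>c x))"

definition etf :: "nat \<Rightarrow> nat \<Rightarrow> complex mat \<Rightarrow> bool" where
  "etf m d \<Phi> \<longleftrightarrow> tight_frame m d \<Phi> \<and>
     (\<forall>i<m. col \<Phi> i \<bullet>c col \<Phi> i = 1) \<and>
     (\<exists>\<alpha>. \<forall>i<m. \<forall>j<m. i \<noteq> j \<longrightarrow> cmod (col \<Phi> i \<bullet>c col \<Phi> j) = \<alpha>)"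

text \<open>The group elements are listed as \<open>1, \<mu>, \<dots>, \<mu>\<^sup>n\<^sup>-\<^sup>1, \<tau>, \<mu>\<tau>, \<dots>, \<mu>\<^sup>n\<^sup>-\<^sup>1\<tau>\<close>.\<close>

definition dihedral_frame_mat ::
  "nat \<Rightarrow> (nat \<times> bool \<Rightarrow> complex mat) \<Rightarrow> complex vec \<Rightarrow> complex mat" where
  "dihedral_frame_mat n \<pi> v =
     mat_of_cols n (map (\<lambda>g. \<pi> g *\<^sub>v v)
       (map (\<lambda>k. (k, False)) [0..<n] @ map (\<lambda>k. (k, True)) [0..<n]))"

definition dihedral_configuration ::
  "nat \<Rightarrow> (nat \<times> bool \<Rightarrow> complex mat) \<Rightarrow> complex vec \<Rightarrow> bool" where
  "dihedral_configuration n \<pi> v \<longleftrightarrow>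
     proj_unitary_rep (dihedral_group n) n \<pi> \<and> v \<in> carrier_vec n \<and> v \<bullet>c v = 1"

definition regular_dihedral ::
  "nat \<Rightarrow> (nat \<times> bool \<Rightarrow> complex mat) \<Rightarrow> complex vec \<Rightarrow> bool" where
  "regular_dihedral n \<pi> v \<longleftrightarrow>
     (let b = \<lambda>k::nat. if k = 0 then v else \<pi> (dih_mu n [^]\<^bsub>dihedral_group n\<^esub> k) *\<^sub>v v
      in inj_on b {0..<n} \<and>
         vectorspace.basis class_ring (module_vec TYPE(complex) n) (b ` {0..<n}))"

section \<open>Switching equivalence\<close>

definition phase_monomial :: "nat \<Rightarrow> complex mat \<Rightarrow> bool" where
  "phase_monomial m M \<longleftrightarrow>
     (\<exists>\<sigma> c. \<sigma> permutes {..<m} \<and> (\<forall>i<m. cmod (c i) = 1) \<and>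
        M = mat m m (\<lambda>(i, j). if j = \<sigma> i then c i else 0))"

definition switching_equivalent :: "nat \<Rightarrow> complex mat \<Rightarrow> complex mat \<Rightarrow> bool" where
  "switching_equivalent m A B \<longleftrightarrow> (\<exists>M. phase_monomial m M \<and> M * A * mat_adjoint M = B)"

section \<open>Skew Hadamard and negacirculant matrices\<close>

definition skew_hadamard :: "nat \<Rightarrow> real mat \<Rightarrow> bool" where
  "skew_hadamard m H \<longleftrightarrow> H \<in> carrier_mat m m \<and>
     (\<forall>i<m. \<forall>j<m. H $$ (i, j) \<in> {1, -1}) \<and>
     H * transpose_mat H = of_nat m \<cdot>\<^sub>m 1\<^sub>m m \<and>
     H + transpose_mat H = 2 \<cdot>\<^sub>m 1\<^sub>m m"

definition negacirculant :: "nat \<Rightarrow> real mat \<Rightarrow> bool" where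
  "negacirculant n W \<longleftrightarrow>
     (\<exists>w. W = mat n n (\<lambda>(i, j). if i \<le> j then w (j - i) else - w (n + j - i)))"

end

theory Submission
  imports Defs "Jordan_Normal_Form.DL_Rank"
begin

text \<open>
  Rescaling by phases makes \<open>M = \<pi>(\<mu>)\<close>, \<open>T = \<pi>(\<tau>)\<close> satisfy
  \<open>T\<^sup>2 = 1\<close>, \<open>M T M = T\<close> and \<open>M\<^sup>n = \<epsilon>\<close>, and
  conjugating by \<open>T\<close> shows \<open>\<epsilon> = \<plusminus>1\<close>. The Gram matrix then
  consists of the blocks \<open>A\<close>, \<open>B\<close>, \<open>B\<^sup>T\<close>,
  \<open>A\<^sup>T\<close> with \<open>A\<close>, \<open>B\<close> circulant for \<open>\<epsilon> = 1\<close>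
  and negacirculant for \<open>\<epsilon> = -1\<close>, where \<open>A\<close> is Hermitian and
  \<open>B\<close> is real. Tightness means that the Gram matrix \<open>G\<close> satisfies \<open>G\<^sup>2 =
  2 G\<close>; its off-diagonal block reads \<open>A B + B A\<^sup>T = 2 B\<close>. Since \<open>A\<close> and
  \<open>B\<close> commute and \<open>B\<close> is invertible by regularity, \<open>A + A\<^sup>T = 2\<close>,
  i.e. the off-diagonal entries of \<open>A\<close> are purely imaginary. This gives \<open>P\<close> and
  \<open>Q\<close>, and the diagonal block of \<open>G\<^sup>2 = 2 G\<close> gives the Hadamard property. A
  Hadamard matrix of order \<open>2 n > 2\<close> forces \<open>n\<close> to be even; if \<open>\<epsilon> =
  1\<close>, the entry of \<open>A\<close> at offset \<open>n / 2\<close> would be real as well as imaginary.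
  So \<open>\<epsilon> = -1\<close> for every choice of phases, whereas a strict representation would allow
  \<open>\<epsilon> = 1\<close>.
\<close>

section \<open>Complex inner products, unitary matrices and tight frames\<close>

lemma cscalar_prod_sum:
  "x \<in> carrier_vec n \<Longrightarrow> y \<in> carrier_vec n \<Longrightarrow> x \<bullet>c y = (\<Sum>i<n. x $ i * cnj (y $ i))"
  for x y :: "complex vec"
  by (auto simp: scalar_prod_def atLeast0LessThan)

lemma cscalar_prod_cnj:
  assumes "x \<in> carrier_vec n" "y \<in> carrier_vec n"
  shows "cnj (x \<bullet>c y) = y \<bullet>c (x :: complex vec)"
  using assms by (simp add: cscalar_prod_sum mult.commute)

lemma cscalar_prod_add_left:
  assumes "x \<in> carrier_vec n" "y \<in> carrier_vec n" "z \<in> carrier_vec n"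
  shows "(x + y) \<bullet>c (z :: complex vec) = x \<bullet>c z + y \<bullet>c z"
  using assms by (simp add: cscalar_prod_sum[where n = n] sum.distrib algebra_simps)

lemma cscalar_prod_add_right:
  assumes "x \<in> carrier_vec n" "y \<in> carrier_vec n" "z \<in> carrier_vec n"
  shows "x \<bullet>c (y + z) = x \<bullet>c y + x \<bullet>c (z :: complex vec)"
  using assms by (simp add: cscalar_prod_sum[where n = n] sum.distrib algebra_simps)

lemma cscalar_prod_smult_left:
  assumes "x \<in> carrier_vec n" "y \<in> carrier_vec n"
  shows "(c \<cdot>\<^sub>v x) \<bullet>c (y :: complex vec) = c * (x \<bullet>c y)"
  using assms by (simp add: cscalar_prod_sum[where n = n] sum_distrib_left algebra_simps)

lemma cscalar_prod_smult_right:
  assumes "x \<in> carrier_vec n" "y \<in> carrier_vec n"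
  shows "x \<bullet>c (c \<cdot>\<^sub>v y) = cnj c * (x \<bullet>c (y :: complex vec))"
  using assms by (simp add: cscalar_prod_sum[where n = n] sum_distrib_left algebra_simps)

lemma mat_adjoint_index:
  "i < dim_col A \<Longrightarrow> j < dim_row A \<Longrightarrow> mat_adjoint A $$ (i, j) = cnj (A $$ (j, i))"
  for A :: "complex mat"
  by (simp add: mat_adjoint_def mat_of_rows_index)

lemma mat_adjoint_carrier:
  "A \<in> carrier_mat m n \<Longrightarrow> mat_adjoint A \<in> carrier_mat n m" for A :: "complex mat"
  by (auto simp: mat_adjoint_def)

lemma mat_adjoint_dim [simp]:
  "dim_row (mat_adjoint A) = dim_col A" "dim_col (mat_adjoint A) = dim_row A"
  for A :: "complex mat"
  by (auto simp: mat_adjoint_def)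

lemma mat_adjoint_smult:
  "mat_adjoint (c \<cdot>\<^sub>m A) = cnj c \<cdot>\<^sub>m mat_adjoint A" for A :: "complex mat"
  by (rule eq_matI) (auto simp: mat_adjoint_index)

lemma mat_adjoint_mult:
  assumes "A \<in> carrier_mat m n" "B \<in> carrier_mat n p"
  shows "mat_adjoint (A * B) = mat_adjoint B * mat_adjoint (A :: complex mat)"
  using assms
  by (intro eq_matI) (auto simp: mat_adjoint_index scalar_prod_def mult.commute)

lemma mat_adjoint_adjoint [simp]: "mat_adjoint (mat_adjoint A) = A" for A :: "complex mat"
  by (rule eq_matI) (auto simp: mat_adjoint_index)

lemma mat_adjoint_one [simp]: "mat_adjoint (1\<^sub>m n) = (1\<^sub>m n :: complex mat)"
  by (rule eq_matI) (auto simp: mat_adjoint_index)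

lemma cscalar_prod_mult_mat_vec:
  assumes "A \<in> carrier_mat m n" "x \<in> carrier_vec n" "y \<in> carrier_vec m"
  shows "(A *\<^sub>v x) \<bullet>c y = x \<bullet>c (mat_adjoint A *\<^sub>v (y :: complex vec))"
proof -
  have "(A *\<^sub>v x) \<bullet>c y = (\<Sum>i<m. \<Sum>j<n. A $$ (i, j) * x $ j * cnj (y $ i))"
    using assms by (auto simp: cscalar_prod_sum[where n = m] scalar_prod_def atLeast0LessThan
        sum_distrib_right intro!: sum.cong)
  also have "\<dots> = (\<Sum>j<n. \<Sum>i<m. A $$ (i, j) * x $ j * cnj (y $ i))"
    by (rule sum.swap)
  also have "\<dots> = x \<bullet>c (mat_adjoint A *\<^sub>v y)"
    using assms by (auto simp: cscalar_prod_sum[where n = n] scalar_prod_def atLeast0LessThan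
        sum_distrib_left mat_adjoint_carrier mat_adjoint_index intro!: sum.cong)
  finally show ?thesis .
qed

lemma gram_index:
  assumes "\<Phi> \<in> carrier_mat d m" "i < m" "j < m"
  shows "(mat_adjoint \<Phi> * \<Phi>) $$ (i, j) = col \<Phi> j \<bullet>c col (\<Phi> :: complex mat) i"
  using assms
  by (auto simp: scalar_prod_def mat_adjoint_index intro!: sum.cong)

lemma smult_smult_mat: "a \<cdot>\<^sub>m (b \<cdot>\<^sub>m A) = (a * b) \<cdot>\<^sub>m (A :: 'a :: semigroup_mult mat)"
  by (rule eq_matI) (auto simp: mult.assoc)

lemma one_smult_mat [simp]: "1 \<cdot>\<^sub>m A = (A :: 'a :: monoid_mult mat)"
  by (rule eq_matI) auto

lemma cmod_1_cnj:
  assumes "cmod c = 1"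
  shows "cnj c * c = 1" "c * cnj c = 1"
  using complex_norm_square[of c] assms by (auto simp: mult.commute)

lemma smult_mult_smult:
  assumes "A \<in> carrier_mat m n" "B \<in> carrier_mat n p"
  shows "(a \<cdot>\<^sub>m A) * (b \<cdot>\<^sub>m B) = (a * b) \<cdot>\<^sub>m (A * (B :: 'a :: comm_ring_1 mat))"
  using assms by (intro eq_matI) auto

section \<open>Products, powers, phase multiples and adjoints of unitary matrices\<close>

lemma unitary_mat_one: "unitary_mat d (1\<^sub>m d)"
  by (simp add: unitary_mat_def)

lemma unitary_mat_mult:
  assumes "unitary_mat d U" "unitary_mat d V"
  shows "unitary_mat d (U * V)"
proof -
  let ?U = "mat_adjoint U" and ?V = "mat_adjoint V"
  have c: "U \<in> carrier_mat d d" "V \<in> carrier_mat d d" "?U \<in> carrier_mat d d" "?V \<in> carrier_mat d d"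
    using assms by (auto simp: unitary_mat_def mat_adjoint_carrier)
  have "?V * ?U * (U * V) = ?V * (?U * U * V)"
    using c by (simp add: assoc_mult_mat[of _ d d _ d _ d])
  also have "\<dots> = 1\<^sub>m d" using assms c by (simp add: unitary_mat_def)
  finally have 1: "?V * ?U * (U * V) = 1\<^sub>m d" .
  have "U * V * (?V * ?U) = U * (V * ?V * ?U)"
    using c by (simp add: assoc_mult_mat[of _ d d _ d _ d])
  also have "\<dots> = 1\<^sub>m d" using assms c by (simp add: unitary_mat_def)
  finally have 2: "U * V * (?V * ?U) = 1\<^sub>m d" .
  show ?thesis unfolding unitary_mat_def mat_adjoint_mult[OF c(1,2)] using c 1 2 by simp
qed

lemma unitary_mat_smult:
  assumes "unitary_mat d U" "cmod c = 1"
  shows "unitary_mat d (c \<cdot>\<^sub>m U)"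
proof -
  have c: "U \<in> carrier_mat d d" "mat_adjoint U \<in> carrier_mat d d"
    using assms by (auto simp: unitary_mat_def mat_adjoint_carrier)
  show ?thesis
    using assms c unfolding unitary_mat_def
    by (simp add: mat_adjoint_smult smult_mult_smult[of _ d d _ d] cmod_1_cnj[OF assms(2)])
qed

lemma unitary_mat_pow: "unitary_mat d U \<Longrightarrow> unitary_mat d (U ^\<^sub>m k)"
  by (induction k) (auto simp: unitary_mat_one unitary_mat_mult unitary_mat_def[of d U])

lemma unitary_mat_carrier: "unitary_mat d U \<Longrightarrow> U \<in> carrier_mat d d"
  by (simp add: unitary_mat_def)

lemma unitary_mat_adjoint: "unitary_mat d U \<Longrightarrow> unitary_mat d (mat_adjoint U)"
  by (simp add: unitary_mat_def mat_adjoint_carrier)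

lemma unitary_mat_isometry:
  assumes "unitary_mat d U" "x \<in> carrier_vec d" "y \<in> carrier_vec d"
  shows "(U *\<^sub>v x) \<bullet>c (U *\<^sub>v y) = x \<bullet>c y"
proof -
  have c: "U \<in> carrier_mat d d" "mat_adjoint U \<in> carrier_mat d d"
    using assms by (auto simp: unitary_mat_def mat_adjoint_carrier)
  have "mat_adjoint U *\<^sub>v (U *\<^sub>v y) = y"
    using c assms by (simp add: assoc_mult_mat_vec[symmetric, of _ d d _ d] unitary_mat_def)
  then show ?thesis using assms c by (simp add: cscalar_prod_mult_mat_vec[of _ d d])
qed

section \<open>Tight frames: polarization and the frame constant\<close>

lemma tight_frame_polarized:
  fixes \<Phi> :: "complex mat"
  assumes "\<Phi> \<in> carrier_mat d m"
    and frame: "\<And>x. x \<in> carrier_vec d \<Longrightarrow> (\<Sum>i<m. (cmod (x \<bullet>c col \<Phi> i))\<^sup>2) = A * Re (x \<bullet>c x)"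
    and x: "x \<in> carrier_vec d" and y: "y \<in> carrier_vec d"
  shows "(\<Sum>i<m. (x \<bullet>c col \<Phi> i) * (col \<Phi> i \<bullet>c y)) = A * (x \<bullet>c y)"
proof -
  \<comment> \<open>\<open>F\<close> is the sesquilinear defect of the frame identity. The
    hypothesis makes it vanish on the diagonal, and over the complex numbers such a form is zero:
    testing \<open>x + y\<close> and \<open>x + \<i> y\<close> gives two independent relations
    between \<open>F x y\<close> and \<open>F y x\<close>.\<close>
  define F where "F x y = (\<Sum>i<m. (x \<bullet>c col \<Phi> i) * cnj (y \<bullet>c col \<Phi> i)) - A * (x \<bullet>c y)" for x y
  have c: "col \<Phi> i \<in> carrier_vec d" for i using assms(1) by auto
  have real: "x \<bullet>c x = of_real (Re (x \<bullet>c x))" if "x \<in> carrier_vec d" for x :: "complex vec"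
    using cscalar_prod_cnj[OF that that] by (simp add: complex_eq_iff)
  have diag: "F x x = 0" if "x \<in> carrier_vec d" for x
    unfolding F_def
    using arg_cong[OF frame[OF that], of complex_of_real] real[OF that]
    by (simp only: complex_norm_square[symmetric] of_real_sum of_real_mult) simp
  have addl: "F (x + y) z = F x z + F y z" and addr: "F z (x + y) = F z x + F z y"
    if "x \<in> carrier_vec d" "y \<in> carrier_vec d" "z \<in> carrier_vec d" for x y z
    using that c by (simp_all add: F_def cscalar_prod_add_left[where n = d]
      cscalar_prod_add_right[where n = d] sum.distrib algebra_simps)
  have sml: "F (k \<cdot>\<^sub>v x) z = k * F x z" and smr: "F z (k \<cdot>\<^sub>v x) = cnj k * F z x"
    if "x \<in> carrier_vec d" "z \<in> carrier_vec d" for k x z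
    using that c by (simp_all add: F_def cscalar_prod_smult_left[where n = d]
      cscalar_prod_smult_right[where n = d] sum_distrib_left algebra_simps)
  have "F (x + y) (x + y) = 0" using x y by (intro diag) auto
  then have 1: "F x y + F y x = 0" using x y diag[OF x] diag[OF y] by (simp add: addl addr add.commute)
  have "F (x + \<i> \<cdot>\<^sub>v y) (x + \<i> \<cdot>\<^sub>v y) = 0" using x y by (intro diag) auto
  then have 2: "- \<i> * F x y + \<i> * F y x = 0"
    using x y diag[OF x] diag[OF y] by (simp add: addl addr sml smr)
  have "F y x = - F x y" using 1 by (simp add: add_eq_0_iff)
  with 2 have "F x y = 0" by simp
  then show ?thesis using x y c by (simp add: F_def cscalar_prod_cnj[where n = d])
qed

text \<open>A trace computation: summing the frame identity over the standard basis and exchanging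
  the sums leaves the \<open>m\<close> squared norms of the columns, each equal to 1.\<close>

lemma tight_frame_constant:
  fixes \<Phi> :: "complex mat"
  assumes "\<Phi> \<in> carrier_mat d m"
    and frame: "\<And>x. x \<in> carrier_vec d \<Longrightarrow> (\<Sum>i<m. (cmod (x \<bullet>c col \<Phi> i))\<^sup>2) = A * Re (x \<bullet>c x)"
    and unit: "\<And>i. i < m \<Longrightarrow> col \<Phi> i \<bullet>c col \<Phi> i = 1"
  shows "A * real d = real m"
proof -
  have "A * real d = (\<Sum>r<d. A * Re (unit_vec d r \<bullet>c (unit_vec d r :: complex vec)))"
    by (simp add: scalar_prod_left_unit)
  also have "\<dots> = (\<Sum>r<d. \<Sum>i<m. (cmod (col \<Phi> i $ r))\<^sup>2)"
  proof (rule sum.cong[OF refl])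
    fix r assume r: "r \<in> {..<d}"
    have "unit_vec d r \<bullet>c col \<Phi> i = cnj (col \<Phi> i $ r)" for i
      using r assms(1) by (subst scalar_prod_left_unit[of _ d]) auto
    then show "A * Re (unit_vec d r \<bullet>c (unit_vec d r :: complex vec)) = (\<Sum>i<m. (cmod (col \<Phi> i $ r))\<^sup>2)"
      using frame[of "unit_vec d r"] by simp
  qed
  also have "\<dots> = (\<Sum>i<m. \<Sum>r<d. (cmod (col \<Phi> i $ r))\<^sup>2)" by (rule sum.swap)
  also have "\<dots> = (\<Sum>i<m. 1)"
  proof (rule sum.cong[OF refl])
    fix i assume i: "i \<in> {..<m}"
    have "complex_of_real (\<Sum>r<d. (cmod (col \<Phi> i $ r))\<^sup>2) = col \<Phi> i \<bullet>c col \<Phi> i"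
      using assms(1) by (subst cscalar_prod_sum[where n = d]) (auto simp: complex_norm_square[symmetric])
    then show "(\<Sum>r<d. (cmod (col \<Phi> i $ r))\<^sup>2) = 1" using unit i
      by (metis lessThan_iff of_real_eq_1_iff)
  qed
  finally show ?thesis by simp
qed

section \<open>The block Gram matrix and its Hadamard matrix\<close>

text \<open>Moving the window by one drops the first summand and appends its translate by one
  period, which has the same value. The induction runs in both directions because negative shifts
  occur in the reflection below.\<close>

lemma sum_periodic_shift:
  fixes f :: "int \<Rightarrow> 'a :: comm_monoid_add"
  assumes "\<And>l. f (l + int n) = f l"
  shows "(\<Sum>k<n. f (int k + c)) = (\<Sum>k<n. f (int k))"
proof -
  have step: "(\<Sum>k<n. f (int k + (c + 1))) = (\<Sum>k<n. f (int k + c))" for c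
  proof (cases n)
    case (Suc m)
    have "(\<Sum>k<Suc m. f (int k + c)) = f c + (\<Sum>k<m. f (int (Suc k) + c))"
      by (subst sum.lessThan_Suc_shift) simp
    also have "\<dots> = (\<Sum>k<m. f (int k + (c + 1))) + f (int m + (c + 1))"
      using assms[of c] Suc by (simp add: algebra_simps)
    finally show ?thesis using Suc by simp
  qed simp
  show ?thesis
  proof (induction c rule: int_induct[where k = 0])
    case (step2 i)
    then show ?case using step[of "i - 1"] by simp
  qed (auto simp: step)
qed

lemma sum_periodic_reflect:
  fixes f :: "int \<Rightarrow> 'a :: comm_monoid_add"
  assumes "\<And>l. f (l + int n) = f l"
  shows "(\<Sum>k<n. f (c - int k)) = (\<Sum>k<n. f (int k))"
proof -
  have "(\<Sum>k<n. f (c - int k)) = (\<Sum>k<n. f (c - int (n - Suc k)))"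
    by (rule sum.nat_diff_reindex[symmetric])
  also have "\<dots> = (\<Sum>k<n. f (int k + (c + 1 - int n)))"
    by (rule sum.cong) (auto simp: of_nat_diff algebra_simps)
  also have "\<dots> = (\<Sum>k<n. f (int k))" by (rule sum_periodic_shift[of f, OF assms])
  finally show ?thesis .
qed

lemma negacirculant_of_antiperiodic:
  assumes "\<And>l. f (l + int n) = - f l"
  shows "negacirculant n (mat n n (\<lambda>(i, j). f (int j - int i)))"
proof -
  have "f (int j - int i) = - f (int (n + j - i))" if "j < i" "i < n" for i j
    using assms[of "int j - int i"] that by (simp add: of_nat_diff algebra_simps)
  then show ?thesis unfolding negacirculant_def
    by (intro exI[of _ "\<lambda>l. f (int l)"] eq_matI) (auto simp: of_nat_diff)
qed

lemma hadamard_order_dvd_4: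
  fixes H :: "real mat"
  assumes H: "H \<in> carrier_mat m m" and pm: "\<And>i j. i < m \<Longrightarrow> j < m \<Longrightarrow> H $$ (i, j) \<in> {1, -1}"
    and orth: "H * transpose_mat H = of_nat m \<cdot>\<^sub>m 1\<^sub>m m" and m: "3 \<le> m"
  shows "4 dvd m"
proof -
  have ip: "(\<Sum>k<m. H $$ (i, k) * H $$ (j, k)) = (if i = j then real m else 0)"
    if "i < m" "j < m" for i j
  proof -
    have "(\<Sum>k<m. H $$ (i, k) * H $$ (j, k)) = (H * transpose_mat H) $$ (i, j)"
      using H that by (simp add: scalar_prod_def atLeast0LessThan)
    then show ?thesis using that unfolding orth by simp
  qed
  \<comment> \<open>For entries that are signs, \<open>t k\<close> is 1 if the first three rows
    agree in column \<open>k\<close> and 0 otherwise. By orthogonality only the squares of row 0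
    survive the summation of the expanded product, so \<open>m / 4\<close> counts these columns and
    is an integer.\<close>
  define t where "t k = (H $$ (0, k) + H $$ (1, k)) * (H $$ (0, k) + H $$ (2, k)) / 4" for k
  have "(\<Sum>k<m. t k) = (\<Sum>k<m. H $$ (0, k) * H $$ (0, k) + H $$ (0, k) * H $$ (2, k)
      + H $$ (1, k) * H $$ (0, k) + H $$ (1, k) * H $$ (2, k)) / 4"
    unfolding t_def sum_divide_distrib by (simp add: algebra_simps)
  also have "\<dots> = real m / 4" using m by (simp add: sum.distrib ip)
  finally have 1: "(\<Sum>k<m. t k) = real m / 4" .
  have "t k \<in> \<int>" if "k < m" for k
    using pm[of 0 k] pm[of 1 k] pm[of 2 k] that m by (auto simp: t_def)
  then have "(\<Sum>k<m. t k) \<in> \<int>" by (intro Ints_sum) auto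
  then obtain z where "real m / 4 = of_int z" unfolding 1 by (elim Ints_cases)
  then have "int m = 4 * z" by linarith
  then show ?thesis by presburger
qed

text \<open>Here \<open>a l\<close> and \<open>b l\<close> stand for the inner products of \<open>M\<^sup>l v\<close> and \<open>M\<^sup>l T v\<close> with \<open>v\<close>.\<close>

locale dihedral_etf_gram =
  fixes n :: nat and \<epsilon> :: real and a b :: "int \<Rightarrow> complex" and \<alpha> :: real
  assumes n_ge_2: "n \<ge> 2"
    and eps: "\<epsilon> * \<epsilon> = 1"
    and alpha: "\<alpha> = 1 / sqrt (2 * real n - 1)"
    and a_period: "a (l + int n) = \<epsilon> * a l"
    and b_period: "b (l + int n) = \<epsilon> * b l"
    and cnj_a: "cnj (a l) = a (- l)"
    and cnj_b: "cnj (b l) = b l"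
    and a_0: "a 0 = 1"
    and a_cmod: "0 < l \<Longrightarrow> l < int n \<Longrightarrow> cmod (a l) = \<alpha>"
    and b_cmod: "0 \<le> l \<Longrightarrow> l < int n \<Longrightarrow> cmod (b l) = \<alpha>"
    and a_imaginary: "0 < l \<Longrightarrow> l < int n \<Longrightarrow> Re (a l) = 0"
    and frame: "(\<Sum>k<n. a (i - int k) * a (int k - j)) + (\<Sum>k<n. b (int k - i) * b (int k - j))
      = 2 * a (i - j)"
begin

text \<open>At offsets between \<open>- n\<close> and \<open>n\<close> the real part of
  \<open>a\<close> lives at 0 only, where it is 1, so \<open>p\<close> is 1 on the diagonal and the
  sign of \<open>Im (a l)\<close> off it. A single formula lets \<open>p\<close> inherit the period
  relation of \<open>a\<close> without case distinctions.\<close>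

definition p :: "int \<Rightarrow> real" where "p l = Re (a l) + Im (a l) / \<alpha>"
definition q :: "int \<Rightarrow> real" where "q l = Re (b l) / \<alpha>"

definition P :: "real mat" where "P = mat n n (\<lambda>(i, j). p (int j - int i))"
definition Q :: "real mat" where "Q = mat n n (\<lambda>(i, j). q (int j - int i))"
definition H :: "real mat" where
  "H = four_block_mat P Q (- transpose_mat Q) (transpose_mat P)"

lemma alpha_pos: "\<alpha> > 0" and alpha_sq: "(2 * real n - 1) * \<alpha>\<^sup>2 = 1"
  using n_ge_2 by (auto simp: alpha power_divide)

lemma p_period: "p (l + int n) = \<epsilon> * p l"
  by (simp add: p_def a_period algebra_simps)

lemma q_period: "q (l + int n) = \<epsilon> * q l"
  by (simp add: q_def b_period)

lemma Im_a_uminus: "Im (a (- l)) = - Im (a l)" and Re_a_uminus: "Re (a (- l)) = Re (a l)"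
  by (simp_all flip: cnj_a)

lemma b_eq: "b l = of_real (\<alpha> * q l)"
  using cnj_b[of l] alpha_pos by (simp add: q_def complex_eq_iff)

lemma a_small:
  assumes "- int n < l" "l < int n" "l \<noteq> 0"
  shows "Re (a l) = 0" "\<bar>Im (a l)\<bar> = \<alpha>"
proof -
  have "Re (a l) = 0 \<and> \<bar>Im (a l)\<bar> = \<alpha>" if "0 < l" "l < int n" for l
    using a_imaginary[OF that] a_cmod[OF that] by (simp add: cmod_eq_Im)
  from this[of l] this[of "- l"] assms show "Re (a l) = 0" "\<bar>Im (a l)\<bar> = \<alpha>"
    by (cases "l > 0"; simp add: Im_a_uminus Re_a_uminus)+
qed

lemma a_eq:
  assumes "- int n < l" "l < int n"
  shows "a l = (if l = 0 then 1 else \<i> * \<alpha> * p l)"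
  using a_small(1)[OF assms] alpha_pos a_0 by (simp add: complex_eq_iff p_def)

lemma p_0: "p 0 = 1" by (simp add: p_def a_0)

lemma p_pm:
  assumes "- int n < l" "l < int n"
  shows "p l \<in> {1, -1}"
proof (cases "l = 0")
  case False
  then show ?thesis using a_small[OF assms False] alpha_pos
    by (auto simp: p_def abs_if field_simps split: if_splits)
qed (simp add: p_0)

lemma q_pm:
  assumes "- int n < l" "l < int n"
  shows "q l \<in> {1, -1}"
proof -
  have pos: "q l \<in> {1, -1}" if "0 \<le> l" "l < int n" for l
  proof -
    have "\<bar>\<alpha> * q l\<bar> = \<alpha>" using b_cmod[OF that] b_eq[of l] by (simp only: norm_of_real)
    then have "\<alpha> * (q l - 1) = 0 \<or> \<alpha> * (q l + 1) = 0"
      by (auto simp: abs_if algebra_simps split: if_splits)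
    then show ?thesis using alpha_pos by auto
  qed
  show ?thesis
  proof (cases "0 \<le> l")
    case False
    \<comment> \<open>Negative offsets are moved up by one period, at the cost of the factor
      \<open>\<epsilon>\<close>, which is a sign.\<close>
    have "q (l + int n) \<in> {1, -1}" using False assms by (intro pos) auto
    moreover have "\<epsilon> = 1 \<or> \<epsilon> = -1" using eps by (simp add: square_eq_1_iff)
    ultimately show ?thesis by (auto simp: q_period)
  qed (use pos assms in auto)
qed

lemma p_skew:
  assumes "- int n < l" "l < int n" "l \<noteq> 0"
  shows "p (- l) = - p l"
  using a_small(1)[OF assms] by (simp add: p_def Re_a_uminus Im_a_uminus)

text \<open>Putting \<open>i + j - k\<close> in place of \<open>k\<close> is legitimate because the
  product picks up \<open>\<epsilon>\<close> twice and is therefore \<open>n\<close>-periodic. This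
  trades inner products of columns of (nega)circulant matrices for inner products of rows.\<close>

lemma reflect:
  fixes f g :: "int \<Rightarrow> real"
  assumes "\<And>l. f (l + int n) = \<epsilon> * f l" "\<And>l. g (l + int n) = \<epsilon> * g l"
  shows "(\<Sum>k<n. f (i - int k) * g (j - int k)) = (\<Sum>k<n. g (int k - i) * f (int k - j))"
proof -
  define h where "h k = g (k - i) * f (k - j)" for k
  have "g (l + int n - i) * f (l + int n - j) = (\<epsilon> * \<epsilon>) * (g (l - i) * f (l - j))" for l
    using assms(1)[of "l - j"] assms(2)[of "l - i"] by (simp add: algebra_simps)
  then have per: "h (l + int n) = h l" for l unfolding eps by (simp add: h_def)
  have "(\<Sum>k<n. f (i - int k) * g (j - int k)) = (\<Sum>k<n. h ((i + j) - int k))"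
    by (simp add: h_def algebra_simps)
  also have "\<dots> = (\<Sum>k<n. h (int k))" by (rule sum_periodic_reflect[of h, OF per])
  finally show ?thesis by (simp add: h_def)
qed

text \<open>Commutativity of the twisted convolution, by the same substitution: one factor gains a
  period while the other loses one, so the signs cancel. It makes \<open>P\<close> and
  \<open>Q\<close> commute.\<close>

lemma reflect':
  fixes f g :: "int \<Rightarrow> real"
  assumes "\<And>l. f (l + int n) = \<epsilon> * f l" "\<And>l. g (l + int n) = \<epsilon> * g l"
  shows "(\<Sum>k<n. f (int k - i) * g (j - int k)) = (\<Sum>k<n. g (int k - i) * f (j - int k))"
proof -
  define h where "h k = g (k - i) * f (j - k)" for k
  have per: "h (l + int n) = h l" for l
  proof -
    have "h l = g (l - i) * (\<epsilon> * f (j - (l + int n)))"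
      using assms(1)[of "j - (l + int n)"] by (simp add: h_def)
    also have "\<dots> = g (l + int n - i) * f (j - (l + int n))"
      using assms(2)[of "l - i"] by (simp add: algebra_simps)
    finally show ?thesis by (simp add: h_def)
  qed
  have "(\<Sum>k<n. f (int k - i) * g (j - int k)) = (\<Sum>k<n. h ((i + j) - int k))"
    by (simp add: h_def algebra_simps)
  also have "\<dots> = (\<Sum>k<n. h (int k))" by (rule sum_periodic_reflect[of h, OF per])
  finally show ?thesis by (simp add: h_def)
qed

text \<open>Write \<open>P = I + S\<close>, where \<open>S\<close> has the offset sequence
  \<open>s\<close>. The real part of the frame identity yields
  \<open>S S^T + Q Q^T = (2n - 1) I\<close>. In \<open>P P^T\<close> the cross terms
  \<open>S + S^T\<close> cancel because \<open>s\<close> is odd, and the extra \<open>I\<close>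
  raises the constant to \<open>2n\<close>.\<close>

lemma pq_rows:
  assumes "i < n" "j < n"
  shows "(\<Sum>k<n. p (int k - int i) * p (int k - int j)) + (\<Sum>k<n. q (int k - int i) * q (int k - int j))
    = (if i = j then 2 * real n else 0)"
proof -
  define s where "s l = Im (a l) / \<alpha>" for l
  define d where "d (i::nat) j = (if i = j then 1 else 0 :: real)" for i j
  have a: "Re (a (int k - int i)) = d k i" if "k < n" "i < n" for k i
    using a_small(1)[of "int k - int i"] that by (auto simp: d_def a_0)
  have "Re (\<Sum>k<n. a (int i - int k) * a (int k - int j)) = (\<Sum>k<n. d k i * d k j + \<alpha>\<^sup>2 * (s (int k - int i) * s (int k - int j)))"
    unfolding Re_sum
  proof (rule sum.cong[OF refl])
    fix k assume "k \<in> {..<n}"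
    moreover have "a (int i - int k) = cnj (a (int k - int i))" by (simp add: cnj_a)
    ultimately show "Re (a (int i - int k) * a (int k - int j)) = d k i * d k j + \<alpha>\<^sup>2 * (s (int k - int i) * s (int k - int j))"
      using assms alpha_pos by (simp add: a s_def power2_eq_square)
  qed
  also have "\<dots> = d i j + \<alpha>\<^sup>2 * (\<Sum>k<n. s (int k - int i) * s (int k - int j))"
    using assms by (simp add: sum.distrib sum_distrib_left d_def if_distrib[of "\<lambda>x. x * _"] cong: if_cong)
  finally have 1: "Re (\<Sum>k<n. a (int i - int k) * a (int k - int j))
      = d i j + \<alpha>\<^sup>2 * (\<Sum>k<n. s (int k - int i) * s (int k - int j))" .
  have bq: "b (int k - int i) = of_real (\<alpha> * q (int k - int i))" for k i by (rule b_eq)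
  have 2: "Re (\<Sum>k<n. b (int k - int i) * b (int k - int j)) = \<alpha>\<^sup>2 * (\<Sum>k<n. q (int k - int i) * q (int k - int j))"
    by (simp add: bq sum_distrib_left power2_eq_square algebra_simps)
  have "d i j + \<alpha>\<^sup>2 * (\<Sum>k<n. s (int k - int i) * s (int k - int j))
      + \<alpha>\<^sup>2 * (\<Sum>k<n. q (int k - int i) * q (int k - int j)) = 2 * d i j"
    using arg_cong[OF frame[of "int i" "int j"], of Re] a[OF assms] unfolding plus_complex.sel 1 2 by simp
  \<comment> \<open>One copy of the Kronecker delta is left over; writing its coefficient 1 as
    \<open>(2n - 1) \<alpha>^2\<close> allows \<open>\<alpha>^2\<close> to be cancelled.\<close>
  then have "\<alpha>\<^sup>2 * ((\<Sum>k<n. s (int k - int i) * s (int k - int j)) + (\<Sum>k<n. q (int k - int i) * q (int k - int j)))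
     = ((2 * real n - 1) * \<alpha>\<^sup>2) * d i j"
    unfolding alpha_sq by (simp add: algebra_simps)
  then have 3: "(\<Sum>k<n. s (int k - int i) * s (int k - int j)) + (\<Sum>k<n. q (int k - int i) * q (int k - int j))
     = (2 * real n - 1) * d i j"
    using alpha_pos by simp
  have p: "p (int k - int i) = d k i + s (int k - int i)" if "k < n" "i < n" for k i
    using a[OF that] by (simp add: p_def s_def)
  have "(\<Sum>k<n. p (int k - int i) * p (int k - int j))
     = (\<Sum>k<n. d k i * d k j + d k i * s (int k - int j) + d k j * s (int k - int i) + s (int k - int i) * s (int k - int j))"
    using assms by (intro sum.cong) (auto simp: p algebra_simps)
  also have "\<dots> = d i j + s (int i - int j) + s (int j - int i) + (\<Sum>k<n. s (int k - int i) * s (int k - int j))"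
    using assms by (simp add: sum.distrib d_def if_distrib[of "\<lambda>x. x * _"] cong: if_cong)
  also have "s (int j - int i) = - s (int i - int j)"
    using Im_a_uminus[of "int i - int j"] by (simp add: s_def)
  finally show ?thesis using 3 by (simp add: d_def split: if_splits)
qed

section \<open>Block identities for \<open>P\<close>, \<open>Q\<close> and the Hadamard matrix
  \<open>H\<close>\<close>

lemma carriers [simp]: "P \<in> carrier_mat n n" "Q \<in> carrier_mat n n" "H \<in> carrier_mat (2 * n) (2 * n)"
  by (auto simp: P_def Q_def H_def)

lemma dims [simp]: "dim_row P = n" "dim_col P = n" "dim_row Q = n" "dim_col Q = n"
  by (auto simp: P_def Q_def)

lemma P_row_Q_row: "P * transpose_mat P + Q * transpose_mat Q = (2 * real n) \<cdot>\<^sub>m 1\<^sub>m n"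
  by (rule eq_matI) (auto simp: scalar_prod_def atLeast0LessThan P_def Q_def pq_rows)

text \<open>Reflection turns these column inner products into row inner products, so
  \<open>pq_rows\<close> applies again. This becomes the lower right block of
  \<open>H H^T\<close>.\<close>

lemma P_col_Q_col: "transpose_mat Q * Q + transpose_mat P * P = (2 * real n) \<cdot>\<^sub>m 1\<^sub>m n"
proof (rule eq_matI)
  fix i j assume "i < dim_row ((2 * real n) \<cdot>\<^sub>m 1\<^sub>m n)" "j < dim_col ((2 * real n) \<cdot>\<^sub>m 1\<^sub>m n)"
  then have ij: "i < n" "j < n" by auto
  have "(transpose_mat Q * Q + transpose_mat P * P) $$ (i, j)
     = (\<Sum>k<n. q (int i - int k) * q (int j - int k)) + (\<Sum>k<n. p (int i - int k) * p (int j - int k))"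
    using ij by (simp add: scalar_prod_def atLeast0LessThan P_def Q_def)
  also have "\<dots> = ((2 * real n) \<cdot>\<^sub>m 1\<^sub>m n) $$ (i, j)"
    using pq_rows[OF ij] ij unfolding reflect[of q q, OF q_period q_period] reflect[of p p, OF p_period p_period]
    by (simp add: add.commute)
  finally show "(transpose_mat Q * Q + transpose_mat P * P) $$ (i, j) = ((2 * real n) \<cdot>\<^sub>m 1\<^sub>m n) $$ (i, j)" .
qed (auto simp: Q_def P_def)

lemma PQ_commute: "P * Q = Q * P"
proof (rule eq_matI)
  fix i j assume "i < dim_row (Q * P)" "j < dim_col (Q * P)"
  then have ij: "i < n" "j < n" by auto
  then show "(P * Q) $$ (i, j) = (Q * P) $$ (i, j)"
    using reflect'[of p q, OF p_period q_period]
    by (simp add: scalar_prod_def atLeast0LessThan P_def Q_def)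
qed (auto simp: Q_def P_def)

lemma P_skew: "P + transpose_mat P = 2 \<cdot>\<^sub>m 1\<^sub>m n"
proof (rule eq_matI)
  fix i j assume "i < dim_row (2 \<cdot>\<^sub>m 1\<^sub>m n :: real mat)" "j < dim_col (2 \<cdot>\<^sub>m 1\<^sub>m n :: real mat)"
  then have ij: "i < n" "j < n" by auto
  then show "(P + transpose_mat P) $$ (i, j) = (2 \<cdot>\<^sub>m 1\<^sub>m n) $$ (i, j)"
    using p_skew[of "int j - int i"] by (auto simp: P_def p_0)
qed (auto simp: P_def)

lemma transpose_H: "transpose_mat H = four_block_mat (transpose_mat P) (- Q) (transpose_mat Q) P"
  by (simp add: H_def transpose_four_block_mat[of P n n Q n "- transpose_mat Q" n] transpose_uminus)

lemma skew_hadamard_H: "skew_hadamard (2 * n) H"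
  unfolding skew_hadamard_def
proof (intro conjI allI impI)
  fix i j assume ij: "i < 2 * n" "j < 2 * n"
  show "H $$ (i, j) \<in> {1, -1}"
  proof (cases "i < n"; cases "j < n")
    assume "i < n" "j < n"
    then show ?thesis using p_pm[of "int j - int i"] by (simp add: H_def P_def)
  next
    assume "i < n" "\<not> j < n"
    then show ?thesis using q_pm[of "int (j - n) - int i"] ij by (simp add: H_def Q_def)
  next
    assume "\<not> i < n" "j < n"
    then show ?thesis using q_pm[of "int (i - n) - int j"] ij by (auto simp: H_def Q_def)
  next
    assume "\<not> i < n" "\<not> j < n"
    then show ?thesis using p_pm[of "int (i - n) - int (j - n)"] ij by (simp add: H_def P_def)
  qed
next
  \<comment> \<open>The off-diagonal blocks of \<open>H H^T\<close> are \<open>- P Q + Q P\<close>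
    and \<open>- Q^T P^T + P^T Q^T\<close>. Both vanish because \<open>P\<close> and
    \<open>Q\<close> commute, the second one after transposing.\<close>
  have t: "transpose_mat Q * transpose_mat P = transpose_mat P * transpose_mat Q"
    using arg_cong[OF PQ_commute, of transpose_mat] by (simp add: transpose_mult[where n = n and nr = n and nc = n])
  have c: "P * (- Q) = - (P * Q)" "(- transpose_mat Q) * transpose_mat P = - (transpose_mat Q * transpose_mat P)"
    "(- transpose_mat Q) * - Q = transpose_mat Q * Q"
    "- (P * Q) + Q * P = 0\<^sub>m n n" "- (transpose_mat Q * transpose_mat P) + transpose_mat P * transpose_mat Q = 0\<^sub>m n n"
    by (auto simp: PQ_commute t simp del: index_mult_mat(1) intro!: eq_matI)
  have "H * transpose_mat H = four_block_mat ((2 * real n) \<cdot>\<^sub>m 1\<^sub>m n) (0\<^sub>m n n) (0\<^sub>m n n) ((2 * real n) \<cdot>\<^sub>m 1\<^sub>m n)"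
    unfolding transpose_H
    unfolding H_def
    by (subst mult_four_block_mat[of _ n n _ n _ n _ _ n _ n])
      (auto simp: c P_row_Q_row P_col_Q_col)
  also have "\<dots> = of_nat (2 * n) \<cdot>\<^sub>m 1\<^sub>m (2 * n)" by (rule eq_matI) auto
  finally show "H * transpose_mat H = of_nat (2 * n) \<cdot>\<^sub>m 1\<^sub>m (2 * n)" .
  have "H + transpose_mat H = four_block_mat (P + transpose_mat P) (Q + - Q) (- transpose_mat Q + transpose_mat Q) (transpose_mat P + P)"
    unfolding transpose_H
    unfolding H_def by (rule add_four_block_mat) auto
  also have "transpose_mat P + P = 2 \<cdot>\<^sub>m 1\<^sub>m n"
    unfolding P_skew[symmetric] by (rule comm_add_mat[of _ n n]) auto
  also have "four_block_mat (P + transpose_mat P) (Q + - Q) (- transpose_mat Q + transpose_mat Q) (2 \<cdot>\<^sub>m 1\<^sub>m n)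
    = 2 \<cdot>\<^sub>m 1\<^sub>m (2 * n)"
    unfolding P_skew by (rule eq_matI) auto
  finally show "H + transpose_mat H = 2 \<cdot>\<^sub>m 1\<^sub>m (2 * n)" .
qed simp

text \<open>As \<open>n\<close> is at least 2, the order \<open>2 * n\<close> lies beyond the
  exceptional Hadamard orders 1 and 2 and is divisible by 4.\<close>

lemma even_n: "even n"
proof -
  have "4 dvd 2 * n"
    using skew_hadamard_H n_ge_2
    by (intro hadamard_order_dvd_4[of H]) (auto simp: skew_hadamard_def)
  then show ?thesis by presburger
qed

text \<open>For \<open>\<epsilon> = 1\<close> the entry \<open>a (n / 2)\<close> would be real as well as imaginary.\<close>

lemma eps_eq: "\<epsilon> = -1"
proof (rule ccontr)
  assume "\<epsilon> \<noteq> -1"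
  then have e: "\<epsilon> = 1" using eps by (simp add: square_eq_1_iff)
  obtain h where h: "n = 2 * h" using even_n by blast
  have "a (int h) = a (- int h)" using a_period[of "- int h"] h e by simp
  then have "Im (a (int h)) = 0" using Im_a_uminus[of "int h"] by simp
  then show False using a_small(2)[of "int h"] h n_ge_2 alpha_pos by simp
qed

text \<open>Off the diagonal, \<open>a\<close> is \<open>\<i> \<alpha> p\<close>. In the lower right
  block the offset is reversed to \<open>i - j\<close>, and the oddness of \<open>p\<close> away
  from 0 produces the sign in \<open>- P + I\<close>.\<close>

lemma displayed_matrix:
  "1\<^sub>m (2 * n) + complex_of_real (1 / sqrt (2 * real n - 1)) \<cdot>\<^sub>m
     four_block_mat
       (\<i> \<cdot>\<^sub>m map_mat complex_of_real (P - 1\<^sub>m n)) (map_mat complex_of_real Q)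
       (map_mat complex_of_real (transpose_mat Q))
       (\<i> \<cdot>\<^sub>m map_mat complex_of_real (- P + 1\<^sub>m n))
   = mat (2 * n) (2 * n) (\<lambda>(i, j).
       if i < n then if j < n then a (int j - int i) else b (int (j - n) - int i)
       else if j < n then b (int (i - n) - int j) else a (int i - int j))" (is "?L = ?R")
proof (rule eq_matI)
  fix i j assume "i < dim_row ?R" "j < dim_col ?R"
  then have ij: "i < 2 * n" "j < 2 * n" by auto
  show "?L $$ (i, j) = ?R $$ (i, j)"
  proof (cases "i < n"; cases "j < n")
    assume "i < n" "j < n"
    then show ?thesis using a_eq[of "int j - int i"] ij
      by (auto simp: P_def p_0 simp flip: alpha)
  next
    assume "i < n" "\<not> j < n"
    then show ?thesis using b_eq[of "int (j - n) - int i"] ij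
      by (auto simp: Q_def simp flip: alpha)
  next
    assume "\<not> i < n" "j < n"
    then show ?thesis using b_eq[of "int (i - n) - int j"] ij
      by (auto simp: Q_def simp flip: alpha)
  next
    assume "\<not> i < n" "\<not> j < n"
    then show ?thesis using a_eq[of "int i - int j"] p_skew[of "int i - int j"] ij
      by (auto simp: P_def p_0 of_nat_diff simp flip: alpha)
  qed
qed (auto simp: P_def Q_def)

lemma negacirculant_PQ: "negacirculant n P" "negacirculant n Q"
  unfolding P_def Q_def
  using p_period q_period by (auto intro!: negacirculant_of_antiperiodic simp: eps_eq)

end

section \<open>Orbits of normalized dihedral representations\<close>

lemma pow_mat_add:
  "A \<in> carrier_mat n n \<Longrightarrow> A ^\<^sub>m (j + k) = A ^\<^sub>m j * (A ^\<^sub>m k :: 'a :: semiring_1 mat)"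
  by (induction k) (auto simp: assoc_mult_mat[of _ n n _ n _ n])

text \<open>The innermost \<open>M * T * M\<close> collapses to \<open>T\<close>, and this repeats
  \<open>k\<close> times.\<close>

lemma pow_mat_sandwich:
  assumes M: "M \<in> carrier_mat n n" and T: "T \<in> carrier_mat n n"
    and MTM: "M * T * M = (T :: 'a :: semiring_1 mat)"
  shows "M ^\<^sub>m k * T * M ^\<^sub>m k = T"
proof (induction k)
  case (Suc k)
  have "M ^\<^sub>m (k + 1) * T * M ^\<^sub>m (1 + k) = M ^\<^sub>m k * (M * T * M) * M ^\<^sub>m k"
    unfolding pow_mat_add[OF M] using M T
    by (simp add: assoc_mult_mat[of _ n n _ n _ n] mult_carrier_mat[of _ n n _ n])
  then show ?case using Suc by (simp add: MTM)
qed (use M T in simp)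

lemma smult_mat_mult_vec:
  "A \<in> carrier_mat m n \<Longrightarrow> x \<in> carrier_vec n \<Longrightarrow> (c \<cdot>\<^sub>m A) *\<^sub>v x = c \<cdot>\<^sub>v (A *\<^sub>v (x :: 'a :: comm_ring_1 vec))"
  by (intro eq_vecI) (auto simp: scalar_prod_def sum_distrib_left mult.assoc)

lemma pow_mat_smult:
  "A \<in> carrier_mat n n \<Longrightarrow> (c \<cdot>\<^sub>m A) ^\<^sub>m k = c ^ k \<cdot>\<^sub>m (A ^\<^sub>m k :: 'a :: comm_ring_1 mat)"
proof (induction k)
  case 0
  then show ?case by (intro eq_matI) auto
next
  case (Suc k)
  then show ?case by (simp add: smult_mult_smult[of _ n n _ n] mult.commute)
qed

text \<open>\<open>M * T * M = T\<close> is the relation \<open>T M = M^-1 T\<close> written without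
  an inverse. With \<open>\<epsilon> = 1\<close> these are the relations of the dihedral group; the
  sign is all that remains of projectivity.\<close>

locale normalized_dihedral_rep =
  fixes n :: nat and M T :: "complex mat" and \<epsilon> :: real
  assumes n_pos: "n > 0"
    and unitary_M: "unitary_mat n M" and unitary_T: "unitary_mat n T"
    and M_pow_n: "M ^\<^sub>m n = of_real \<epsilon> \<cdot>\<^sub>m 1\<^sub>m n" and eps: "\<epsilon> * \<epsilon> = 1"
    and T_sq: "T * T = 1\<^sub>m n" and MTM: "M * T * M = T"
begin

text \<open>Since \<open>M\<^sup>2\<^sup>n = 1\<close>, reducing exponents modulo \<open>2n\<close> yields integer powers of \<open>M\<close>.\<close>

definition Mz :: "int \<Rightarrow> complex mat" where "Mz l = M ^\<^sub>m nat (l mod int (2 * n))"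

lemma carrier_MT [simp]: "M \<in> carrier_mat n n" "T \<in> carrier_mat n n"
  using unitary_M unitary_T by (auto simp: unitary_mat_carrier)

lemma Tv_carrier [simp]: "x \<in> carrier_vec n \<Longrightarrow> T *\<^sub>v x \<in> carrier_vec n"
  by (rule mult_mat_vec_carrier[OF carrier_MT(2)])

lemma dim_MT [simp]: "dim_row M = n" "dim_col M = n" "dim_row T = n" "dim_col T = n"
  using carrier_matD[OF carrier_MT(1)] carrier_matD[OF carrier_MT(2)] by auto

lemma carrier_pow [simp]: "M ^\<^sub>m k \<in> carrier_mat n n"
  using unitary_mat_pow[OF unitary_M] by (rule unitary_mat_carrier)

lemma unitary_Mz: "unitary_mat n (Mz l)"
  unfolding Mz_def by (rule unitary_mat_pow[OF unitary_M])

lemma carrier_Mz [simp]: "Mz l \<in> carrier_mat n n"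
  using unitary_Mz by (rule unitary_mat_carrier)

lemma M_pow_2n: "M ^\<^sub>m (2 * n) = 1\<^sub>m n"
proof -
  have "M ^\<^sub>m (2 * n) = of_real (\<epsilon> * \<epsilon>) \<cdot>\<^sub>m 1\<^sub>m n"
    unfolding mult_2 pow_mat_add[OF carrier_MT(1)] M_pow_n by (simp add: smult_mult_smult[of _ n n _ n])
  then show ?thesis unfolding eps by (intro eq_matI) auto
qed

lemma M_pow_mod: "M ^\<^sub>m k = M ^\<^sub>m (k mod (2 * n))"
proof -
  have "M ^\<^sub>m (2 * n * j) = 1\<^sub>m n" for j
    by (induction j) (auto simp: pow_mat_add[OF carrier_MT(1)] M_pow_2n)
  then have "M ^\<^sub>m (2 * n * (k div (2 * n)) + k mod (2 * n)) = M ^\<^sub>m (k mod (2 * n))"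
    by (subst pow_mat_add[OF carrier_MT(1)]) simp
  then show ?thesis by simp
qed

lemma Mz_int: "Mz (int k) = M ^\<^sub>m k"
  unfolding Mz_def M_pow_mod[of k] zmod_int[symmetric] nat_int ..

lemma Mz_0: "Mz 0 = 1\<^sub>m n"
  using Mz_int[of 0] by simp

lemma Mz_add: "Mz (k + l) = Mz k * Mz l"
proof -
  have "int ((nat (k mod int (2 * n)) + nat (l mod int (2 * n))) mod (2 * n)) = (k + l) mod int (2 * n)"
    using n_pos by (simp add: zmod_int mod_add_eq)
  then have e: "nat ((k + l) mod int (2 * n)) = (nat (k mod int (2 * n)) + nat (l mod int (2 * n))) mod (2 * n)"
    by (metis nat_int)
  show ?thesis
    unfolding Mz_def e pow_mat_add[OF carrier_MT(1), symmetric]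
    by (rule M_pow_mod[symmetric])
qed

lemma Mz_period: "Mz (l + int n) = of_real \<epsilon> \<cdot>\<^sub>m Mz l"
  unfolding Mz_add Mz_int M_pow_n
  by (simp add: mult_smult_distrib[of _ n n _ n] right_mult_one_mat[of _ n n])

lemma Mz_T_Mz: "Mz l * T * Mz l = T"
  unfolding Mz_def by (rule pow_mat_sandwich[OF carrier_MT MTM])

lemma T_Mz: "T * Mz l = Mz (- l) * T"
proof -
  have "Mz (- l) * T = Mz (- l) * (Mz l * T * Mz l)" by (simp add: Mz_T_Mz)
  also have "\<dots> = (Mz (- l) * Mz l) * (T * Mz l)" by (simp add: assoc_mult_mat[of _ n n _ n _ n] mult_carrier_mat[of _ n n _ n])
  also have "Mz (- l) * Mz l = 1\<^sub>m n" using Mz_add[of "- l" l] by (simp add: Mz_0)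
  finally show ?thesis by simp
qed

end

locale normalized_dihedral_orbit = normalized_dihedral_rep +
  fixes v :: "complex vec"
  assumes v_carrier [simp]: "v \<in> carrier_vec n"
begin

definition u :: "int \<Rightarrow> complex vec" where "u l = Mz l *\<^sub>v v"
definition w :: "int \<Rightarrow> complex vec" where "w l = Mz l *\<^sub>v (T *\<^sub>v v)"
definition a :: "int \<Rightarrow> complex" where "a l = u l \<bullet>c v"
definition b :: "int \<Rightarrow> complex" where "b l = w l \<bullet>c v"

lemma uw_carrier [simp]: "u l \<in> carrier_vec n" "w l \<in> carrier_vec n"
  by (auto simp: u_def w_def intro!: mult_mat_vec_carrier[of _ n n])

lemma Mz_u: "Mz k *\<^sub>v u l = u (k + l)"
  by (simp add: u_def Mz_add assoc_mult_mat_vec[of _ n n _ n])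

lemma Mz_w: "Mz k *\<^sub>v w l = w (k + l)"
  by (simp add: w_def Mz_add assoc_mult_mat_vec[of _ n n _ n])

lemma u_0: "u 0 = v"
  by (simp add: u_def Mz_0)

lemma T_u: "T *\<^sub>v u l = w (- l)"
  by (simp add: u_def w_def T_Mz assoc_mult_mat_vec[of _ n n _ n, symmetric])

lemma T_w: "T *\<^sub>v w l = u (- l)"
proof -
  have "T *\<^sub>v w l = T *\<^sub>v (T *\<^sub>v u (- l))" by (simp add: T_u)
  also have "\<dots> = u (- l)"
    using assoc_mult_mat_vec[of T n n T n "u (- l)"] by (simp add: T_sq)
  finally show ?thesis .
qed

lemma u_u: "u i \<bullet>c u j = a (i - j)"
  using unitary_mat_isometry[OF unitary_Mz, of "u i" "u j" "- j"] by (simp add: Mz_u u_0 a_def)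

lemma w_u: "w i \<bullet>c u j = b (i - j)"
  using unitary_mat_isometry[OF unitary_Mz, of "w i" "u j" "- j"] by (simp add: Mz_u Mz_w u_0 b_def)

text \<open>Applying \<open>T\<close> reduces this to \<open>u_u\<close>; as \<open>T\<close>
  inverts rotations, the offset gets reversed. Hence the lower right Gram block is the transpose of
  the upper left one.\<close>

lemma w_w: "w i \<bullet>c w j = a (j - i)"
  using unitary_mat_isometry[OF unitary_T, of "w i" "w j"] by (simp add: T_w u_u)

lemma cnj_a: "cnj (a l) = a (- l)"
  using cscalar_prod_cnj[of "u l" n "u 0"] by (simp add: u_u)

text \<open>Conceptually, \<open>Mz l * T\<close> is a unitary involution, hence self-adjoint, so
  its expectation at \<open>v\<close> is real. The computation applies \<open>T\<close> to both
  arguments of the inner product.\<close>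

lemma cnj_b: "cnj (b l) = b l"
proof -
  have "cnj (b l) = u 0 \<bullet>c w l"
    using cscalar_prod_cnj[of "w l" n "u 0"] by (simp add: w_u)
  also have "\<dots> = w 0 \<bullet>c u (- l)"
    using unitary_mat_isometry[OF unitary_T, of "u 0" "w l"] by (simp add: T_u T_w)
  finally show ?thesis by (simp add: w_u)
qed

lemma u_w: "u i \<bullet>c w j = b (j - i)"
  using cscalar_prod_cnj[of "w j" n "u i"] by (simp add: w_u cnj_b)

lemma a_period: "a (l + int n) = of_real \<epsilon> * a l"
proof -
  have "u (l + int n) = of_real \<epsilon> \<cdot>\<^sub>v u l"
    unfolding u_def Mz_period by (simp add: smult_mat_mult_vec[of _ n n])
  then show ?thesis by (simp add: a_def cscalar_prod_smult_left[where n = n])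
qed

lemma b_period: "b (l + int n) = of_real \<epsilon> * b l"
proof -
  have "w (l + int n) = of_real \<epsilon> \<cdot>\<^sub>v w l"
    unfolding w_def Mz_period by (simp add: smult_mat_mult_vec[of _ n n])
  then show ?thesis by (simp add: b_def cscalar_prod_smult_left[where n = n])
qed

end

text \<open>The frame identity appears in polarized form with the constant
  \<open>2 = 2n / n\<close>. Regularity is encoded by the determinant of the matrix with columns
  \<open>u 0, ..., u (n - 1)\<close>, the form in which linear systems get solved below.\<close>

locale regular_dihedral_etf = normalized_dihedral_orbit +
  assumes n_ge_2: "n \<ge> 2"
    and unit_v: "v \<bullet>c v = 1"
    and frame: "\<And>x y. x \<in> carrier_vec n \<Longrightarrow> y \<in> carrier_vec n \<Longrightarrow>
      (\<Sum>k<n. (x \<bullet>c u (int k)) * (u (int k) \<bullet>c y)) + (\<Sum>k<n. (x \<bullet>c w (int k)) * (w (int k) \<bullet>c y))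
      = 2 * (x \<bullet>c y)"
    and regular: "det (mat n n (\<lambda>(i, k). u (int k) $ i)) \<noteq> 0"
    and equiangular: "\<And>l. 0 < l \<Longrightarrow> l < int n \<Longrightarrow> cmod (a l) = 1 / sqrt (2 * real n - 1)"
      "\<And>l. 0 \<le> l \<Longrightarrow> l < int n \<Longrightarrow> cmod (b l) = 1 / sqrt (2 * real n - 1)"
begin

lemma combination_inner:
  assumes "z \<in> carrier_vec n" "y \<in> carrier_vec n"
  shows "(mat n n (\<lambda>(i, k). u (int k) $ i) *\<^sub>v z) \<bullet>c y = (\<Sum>k<n. z $ k * (u (int k) \<bullet>c y))"
proof -
  have "(mat n n (\<lambda>(i, k). u (int k) $ i) *\<^sub>v z) \<bullet>c y
    = (\<Sum>i<n. \<Sum>k<n. u (int k) $ i * z $ k * cnj (y $ i))"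
    using assms by (subst cscalar_prod_sum[where n = n])
      (auto simp: scalar_prod_def atLeast0LessThan sum_distrib_right intro!: sum.cong mult_mat_vec_carrier)
  also have "\<dots> = (\<Sum>k<n. \<Sum>i<n. u (int k) $ i * z $ k * cnj (y $ i))"
    by (rule sum.swap)
  also have "\<dots> = (\<Sum>k<n. z $ k * (u (int k) \<bullet>c y))"
    using assms by (simp add: cscalar_prod_sum[where n = n] sum_distrib_left mult_ac)
  finally show ?thesis .
qed

text \<open>The columns of an invertible matrix span, so \<open>x\<close> is a combination of
  vectors orthogonal to \<open>x\<close>, and its norm vanishes.\<close>

lemma total:
  assumes x: "x \<in> carrier_vec n" and orth: "\<And>k. k < n \<Longrightarrow> x \<bullet>c u (int k) = 0"
  shows "x = 0\<^sub>v n"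
proof -
  let ?A = "mat n n (\<lambda>(i, k). u (int k) $ i)"
  obtain B where B: "B \<in> carrier_mat n n" "?A * B = 1\<^sub>m n"
    using det_non_zero_imp_unit[of ?A n "()"] regular
    by (auto simp: Units_def ring_mat_def)
  have "?A *\<^sub>v (B *\<^sub>v x) = x"
    using B x by (simp add: assoc_mult_mat_vec[symmetric, of _ n n _ n])
  then have "x \<bullet>c x = (\<Sum>k<n. (B *\<^sub>v x) $ k * (u (int k) \<bullet>c x))"
    using combination_inner[of "B *\<^sub>v x" x] B x by (simp add: mult_mat_vec_carrier)
  also have "u (int k) \<bullet>c x = 0" if "k < n" for k
    using orth[OF that] cscalar_prod_cnj[of x n "u (int k)"] x by simp
  then have "(\<Sum>k<n. (B *\<^sub>v x) $ k * (u (int k) \<bullet>c x)) = 0" by simp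
  finally show ?thesis using x by simp
qed

text \<open>
  The frame equation for \<open>x = w i\<close>, \<open>y = v\<close> says that \<open>\<Sum>k. z k \<langle>u k, w i\<rangle> = 0\<close> for all \<open>i\<close>, where
  \<open>z k = a k + a (- k) - 2 \<delta>\<^sub>k\<^sub>0\<close>; the commutativity of convolution is hidden in the reflection of the sum.
  Both \<open>(u k)\<close> and \<open>(w i)\<close> being bases, \<open>z\<close> vanishes.
\<close>

lemma a_imaginary:
  assumes "0 < l" "l < int n"
  shows "Re (a l) = 0"
proof -
  define A where "A = mat n n (\<lambda>(i, k). u (int k) $ i)"
  define z where "z = vec n (\<lambda>k. a (int k) + a (- int k) - 2 * (if k = 0 then 1 else 0))"
  have z: "z \<in> carrier_vec n" by (simp add: z_def)
  have A: "A \<in> carrier_mat n n" by (simp add: A_def)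
  have Az: "A *\<^sub>v z \<in> carrier_vec n" using A z by (rule mult_mat_vec_carrier)
  have orth_w: "(A *\<^sub>v z) \<bullet>c w i = 0" for i
  proof -
    \<comment> \<open>The second sum of the frame identity at \<open>w i\<close> and
      \<open>u 0\<close> has the summands \<open>h k\<close>. Reflecting it gives the summands
      \<open>a (- k) * b (i - k)\<close>, which match the shape of the first sum.\<close>
    define h where "h k = a (k - i) * b k" for k
    have "h (l + int n) = h l" for l
    proof -
      have "h (l + int n) = complex_of_real (\<epsilon> * \<epsilon>) * h l"
        using a_period[of "l - i"] b_period[of l] by (simp add: h_def algebra_simps)
      then show ?thesis by (simp add: eps)
    qed
    then have "(\<Sum>k<n. h (i - int k)) = (\<Sum>k<n. h (int k))"
      by (rule sum_periodic_reflect[of h])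
    then have "(\<Sum>k<n. b (i - int k) * a (int k)) + (\<Sum>k<n. a (- int k) * b (i - int k)) = 2 * b i"
      using frame[of "w i" "u 0"] by (simp add: u_u w_u w_w h_def)
    moreover have "(A *\<^sub>v z) \<bullet>c w i = (\<Sum>k<n. z $ k * b (i - int k))"
      using z by (simp add: A_def combination_inner u_w)
    moreover have "\<dots> = (\<Sum>k<n. b (i - int k) * a (int k)) + (\<Sum>k<n. a (- int k) * b (i - int k)) - 2 * b i"
    proof -
      have "(\<Sum>k<n. z $ k * b (i - int k)) = (\<Sum>k<n. b (i - int k) * a (int k) + a (- int k) * b (i - int k)
          - (if k = 0 then 2 * b i else 0))"
        by (intro sum.cong) (auto simp: z_def algebra_simps)
      also have "\<dots> = (\<Sum>k<n. b (i - int k) * a (int k)) + (\<Sum>k<n. a (- int k) * b (i - int k)) - 2 * b i"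
        using n_pos by (simp add: sum.distrib sum_subtractf)
      finally show ?thesis .
    qed
    ultimately show ?thesis by simp
  qed
  \<comment> \<open>\<open>total\<close> speaks of the vectors \<open>u k\<close>; since
    \<open>T\<close> carries \<open>w (- l)\<close> to \<open>u l\<close>, applying \<open>T\<close>
    transports the orthogonality there.\<close>
  have "(T *\<^sub>v (A *\<^sub>v z)) \<bullet>c u l = 0" for l
  proof -
    have "(T *\<^sub>v (A *\<^sub>v z)) \<bullet>c u l = (T *\<^sub>v (A *\<^sub>v z)) \<bullet>c (T *\<^sub>v w (- l))" by (simp add: T_w)
    also have "\<dots> = (A *\<^sub>v z) \<bullet>c w (- l)" by (rule unitary_mat_isometry[OF unitary_T Az]) simp
    finally show ?thesis by (simp add: orth_w)
  qed
  then have "T *\<^sub>v (A *\<^sub>v z) = 0\<^sub>v n" by (intro total) (auto intro!: mult_mat_vec_carrier[OF carrier_MT(2) Az])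
  then have "(A *\<^sub>v z) \<bullet>c (A *\<^sub>v z) = 0"
    using unitary_mat_isometry[OF unitary_T Az Az] by simp
  then have "A *\<^sub>v z = 0\<^sub>v n" using Az by simp
  then have "z = 0\<^sub>v n" using det_0_iff_vec_prod_zero[OF A] regular z unfolding A_def by blast
  moreover obtain k where k: "l = int k" "0 < k" "k < n"
    using assms by (metis nat_0_le less_imp_le nat_less_iff zero_less_nat_eq)
  ultimately have "z $ k = 0" by simp
  then have "a l + a (- l) = 0" using k by (simp add: z_def)
  then show ?thesis by (simp add: complex_eq_iff flip: cnj_a)
qed

text \<open>The frame identity at \<open>u i\<close> and \<open>u j\<close> is the diagonal block of
  \<open>G^2 = 2 G\<close>; the off-diagonal block has entered through
  \<open>a_imaginary\<close>.\<close>

sublocale dihedral_etf_gram n \<epsilon> a b "1 / sqrt (2 * real n - 1)"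
proof
  fix i j
  show "(\<Sum>k<n. a (i - int k) * a (int k - j)) + (\<Sum>k<n. b (int k - i) * b (int k - j)) = 2 * a (i - j)"
    using frame[of "u i" "u j"] by (simp add: u_u u_w w_u)
qed (use n_ge_2 eps a_period b_period cnj_a cnj_b equiangular a_imaginary unit_v u_0 in \<open>auto simp: a_def\<close>)

end

section \<open>Normalizing projective dihedral representations\<close>

lemma proj_rep_mult:
  assumes "proj_unitary_rep G d \<pi>" "g \<in> carrier G" "h \<in> carrier G"
  obtains c where "cmod c = 1" "\<pi> g * \<pi> h = c \<cdot>\<^sub>m \<pi> (g \<otimes>\<^bsub>G\<^esub> h)"
proof -
  obtain c where c: "cmod c = 1" "\<pi> (g \<otimes>\<^bsub>G\<^esub> h) = c \<cdot>\<^sub>m (\<pi> g * \<pi> h)"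
    using assms unfolding proj_unitary_rep_def by blast
  have "\<pi> g * \<pi> h = cnj c \<cdot>\<^sub>m \<pi> (g \<otimes>\<^bsub>G\<^esub> h)"
    using cmod_1_cnj[OF c(1)] by (simp add: c(2) smult_smult_mat)
  then show ?thesis using c(1) by (intro that[of "cnj c"]) auto
qed

lemma proj_rep_unitary:
  "proj_unitary_rep G d \<pi> \<Longrightarrow> g \<in> carrier G \<Longrightarrow> unitary_mat d (\<pi> g)"
  by (simp add: proj_unitary_rep_def)

text \<open>The unitary image \<open>U\<close> of the identity satisfies \<open>U * U = c U\<close>;
  cancelling one factor leaves a scalar matrix.\<close>

lemma proj_rep_one:
  assumes "group G" and rep: "proj_unitary_rep G d \<pi>"
  obtains c where "cmod c = 1" "\<pi> \<one>\<^bsub>G\<^esub> = c \<cdot>\<^sub>m 1\<^sub>m d"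
proof -
  interpret group G by fact
  let ?U = "\<pi> \<one>\<^bsub>G\<^esub>"
  obtain c where c: "cmod c = 1" "?U * ?U = c \<cdot>\<^sub>m ?U"
    using proj_rep_mult[OF rep one_closed one_closed] by auto
  have U: "?U \<in> carrier_mat d d" "mat_adjoint ?U \<in> carrier_mat d d" "mat_adjoint ?U * ?U = 1\<^sub>m d"
    using proj_rep_unitary[OF rep one_closed] by (auto simp: unitary_mat_def mat_adjoint_carrier)
  have "?U = mat_adjoint ?U * ?U * ?U" using U by simp
  also have "\<dots> = mat_adjoint ?U * (?U * ?U)" using U(2,1,1) by (rule assoc_mult_mat)
  also have "\<dots> = mat_adjoint ?U * (c \<cdot>\<^sub>m ?U)" by (simp only: c(2))
  also have "\<dots> = c \<cdot>\<^sub>m 1\<^sub>m d"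
    using U by (simp add: mult_smult_distrib[of _ d d _ d])
  finally show ?thesis using c(1) that by blast
qed

section \<open>Relations between the dihedral generators up to phases\<close>

lemma carrier_dihedral [simp]: "(k, e) \<in> carrier (dihedral_group n) \<longleftrightarrow> k < n"
  by (simp add: dihedral_group_def)

lemma mult_dihedral [simp]:
  "(a, e) \<otimes>\<^bsub>dihedral_group n\<^esub> (b, f) = ((a + (if e then n - b else b)) mod n, e \<noteq> f)"
  by (simp add: dihedral_group_def)

lemma one_dihedral: "\<one>\<^bsub>dihedral_group n\<^esub> = (0, False)"
  by (simp add: dihedral_group_def)

context
  fixes n d :: nat and \<pi> :: "nat \<times> bool \<Rightarrow> complex mat"
  assumes rep: "proj_unitary_rep (dihedral_group n) d \<pi>" and n: "n \<ge> 2"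
begin

lemma dihedral_rep_carrier: "k < n \<Longrightarrow> \<pi> (k, e) \<in> carrier_mat d d"
  using proj_rep_unitary[OF rep, of "(k, e)"] by (simp add: unitary_mat_carrier)

lemma dihedral_rep_one: obtains c where "cmod c = 1" "\<pi> (0, False) = c \<cdot>\<^sub>m 1\<^sub>m d"
  using proj_rep_one[OF group_dihedral_group rep] n by (auto simp: one_dihedral)

text \<open>The bound includes \<open>k = n\<close>, where the exponent wraps around to the
  identity; this case shows that the \<open>n\<close>-th power is scalar.\<close>

lemma dihedral_rep_pow:
  "k \<le> n \<Longrightarrow> \<exists>c. cmod c = 1 \<and> \<pi> (1, False) ^\<^sub>m k = c \<cdot>\<^sub>m \<pi> (k mod n, False)"
proof (induction k)
  case 0
  obtain c where c: "cmod c = 1" "\<pi> (0, False) = c \<cdot>\<^sub>m 1\<^sub>m d" by (rule dihedral_rep_one)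
  have "\<pi> (1, False) ^\<^sub>m 0 = 1\<^sub>m d" using dihedral_rep_carrier[of 1 False] n by simp
  also have "\<dots> = cnj c \<cdot>\<^sub>m \<pi> (0, False)"
    using cmod_1_cnj[OF c(1)] by (simp add: c(2) smult_smult_mat)
  finally show ?case using c(1) by (intro exI[of _ "cnj c"]) simp
next
  case (Suc k)
  then obtain c where c: "cmod c = 1" "\<pi> (1, False) ^\<^sub>m k = c \<cdot>\<^sub>m \<pi> (k, False)"
    by auto
  have k: "k < n" using Suc by simp
  obtain c' where c': "cmod c' = 1" "\<pi> (k, False) * \<pi> (1, False) = c' \<cdot>\<^sub>m \<pi> (Suc k mod n, False)"
    using proj_rep_mult[OF rep, of "(k, False)" "(1, False)"] k n by auto
  have "\<pi> (1, False) ^\<^sub>m Suc k = (c * c') \<cdot>\<^sub>m \<pi> (Suc k mod n, False)"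
    using dihedral_rep_carrier[OF k] dihedral_rep_carrier[of 1 False] n
    by (simp add: c(2) mult_smult_assoc_mat[of _ d d _ d] c'(2) smult_smult_mat del: One_nat_def)
  then show ?case using c(1) c'(1) by (intro exI[of _ "c * c'"]) (simp add: norm_mult)
qed

lemma dihedral_rep_pow_n: obtains c where "cmod c = 1" "\<pi> (1, False) ^\<^sub>m n = c \<cdot>\<^sub>m 1\<^sub>m d"
proof -
  obtain c where c: "cmod c = 1" "\<pi> (1, False) ^\<^sub>m n = c \<cdot>\<^sub>m \<pi> (0, False)"
    using dihedral_rep_pow[of n] by auto
  obtain c' where c': "cmod c' = 1" "\<pi> (0, False) = c' \<cdot>\<^sub>m 1\<^sub>m d" by (rule dihedral_rep_one)
  show ?thesis using c c' by (intro that[of "c * c'"]) (auto simp: smult_smult_mat norm_mult)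
qed

lemma dihedral_rep_tau_sq: obtains c where "cmod c = 1" "\<pi> (0, True) * \<pi> (0, True) = c \<cdot>\<^sub>m 1\<^sub>m d"
proof -
  obtain c where c: "cmod c = 1" "\<pi> (0, True) * \<pi> (0, True) = c \<cdot>\<^sub>m \<pi> (0, False)"
    using proj_rep_mult[OF rep, of "(0, True)" "(0, True)"] n by auto
  obtain c' where c': "cmod c' = 1" "\<pi> (0, False) = c' \<cdot>\<^sub>m 1\<^sub>m d" by (rule dihedral_rep_one)
  show ?thesis using c c' by (intro that[of "c * c'"]) (auto simp: smult_smult_mat norm_mult)
qed

lemma dihedral_rep_mu_tau_mu:
  obtains c where "cmod c = 1" "\<pi> (1, False) * \<pi> (0, True) * \<pi> (1, False) = c \<cdot>\<^sub>m \<pi> (0, True)"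
proof -
  obtain c where c: "cmod c = 1" "\<pi> (1, False) * \<pi> (0, True) = c \<cdot>\<^sub>m \<pi> (1, True)"
    using proj_rep_mult[OF rep, of "(1, False)" "(0, True)"] n by auto
  obtain c' where c': "cmod c' = 1" "\<pi> (1, True) * \<pi> (1, False) = c' \<cdot>\<^sub>m \<pi> (0, True)"
    using proj_rep_mult[OF rep, of "(1, True)" "(1, False)"] n by auto
  have "\<pi> (1, False) * \<pi> (0, True) * \<pi> (1, False) = (c * c') \<cdot>\<^sub>m \<pi> (0, True)"
    using dihedral_rep_carrier[of 1] n
    by (simp add: c(2) mult_smult_assoc_mat[of _ d d _ d] c'(2) smult_smult_mat del: One_nat_def)
  then show ?thesis using c(1) c'(1) by (intro that[of "c * c'"]) (auto simp: norm_mult)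
qed

end

lemma unit_sqrt_inverse:
  assumes "cmod c = 1"
  obtains x where "cmod x = 1" "x * x * c = 1"
proof
  have "csqrt (cnj c) * csqrt (cnj c) = cnj c" using power2_csqrt[of "cnj c"] by (simp add: power2_eq_square)
  then show "csqrt (cnj c) * csqrt (cnj c) * c = 1" using cmod_1_cnj[OF assms] by simp
  show "cmod (csqrt (cnj c)) = 1" using assms by (simp add: norm_csqrt)
qed

text \<open>Two phases are free: \<open>y\<close> absorbs the scalar of the squared reflection and
  \<open>x\<close> that of the product for \<open>\<mu> \<tau> \<mu>\<close>. The scalar of
  \<open>M^n\<close> is then forced to be a sign.\<close>

lemma normalize_dihedral_rep:
  assumes rep: "proj_unitary_rep (dihedral_group n) n \<pi>" and n: "n \<ge> 2"
  obtains x y \<epsilon> where "cmod x = 1" "cmod y = 1"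
    "normalized_dihedral_rep n (x \<cdot>\<^sub>m \<pi> (1, False)) (y \<cdot>\<^sub>m \<pi> (0, True)) \<epsilon>"
proof -
  let ?X = "\<pi> (1, False)" and ?Y = "\<pi> (0, True)"
  have uni: "unitary_mat n ?X" "unitary_mat n ?Y"
    using proj_rep_unitary[OF rep, of "(1, False)"] proj_rep_unitary[OF rep, of "(0, True)"] n by auto
  then have carr: "?X \<in> carrier_mat n n" "?Y \<in> carrier_mat n n" by (simp_all add: unitary_mat_carrier)
  obtain c where c: "cmod c = 1" "?Y * ?Y = c \<cdot>\<^sub>m 1\<^sub>m n" by (rule dihedral_rep_tau_sq[OF rep n])
  obtain y where y: "cmod y = 1" "y * y * c = 1" using unit_sqrt_inverse[OF c(1)] .
  obtain c' where c': "cmod c' = 1" "?X * ?Y * ?X = c' \<cdot>\<^sub>m ?Y" by (rule dihedral_rep_mu_tau_mu[OF rep n])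
  obtain x where x: "cmod x = 1" "x * x * c' = 1" using unit_sqrt_inverse[OF c'(1)] .
  obtain c'' where c'': "cmod c'' = 1" "?X ^\<^sub>m n = c'' \<cdot>\<^sub>m 1\<^sub>m n" by (rule dihedral_rep_pow_n[OF rep n])
  define M where "M = x \<cdot>\<^sub>m ?X"
  define T where "T = y \<cdot>\<^sub>m ?Y"
  have M: "unitary_mat n M" and T: "unitary_mat n T"
    using uni x y by (simp_all add: M_def T_def unitary_mat_smult)
  note MT = unitary_mat_carrier[OF M] unitary_mat_carrier[OF T]
  have TT: "T * T = 1\<^sub>m n"
    using carr by (simp add: T_def smult_mult_smult[of _ n n _ n] c smult_smult_mat y)
  have "M * T * M = (x * y * x) \<cdot>\<^sub>m (?X * ?Y * ?X)"
    using carr by (simp add: M_def T_def smult_mult_smult[of _ n n _ n] mult_carrier_mat[of _ n n _ n])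
  also have "\<dots> = (y * (x * x * c')) \<cdot>\<^sub>m ?Y"
    by (simp add: c'(2) smult_smult_mat mult_ac del: One_nat_def)
  finally have MTM: "M * T * M = T" by (simp add: x T_def)
  define e where "e = x ^ n * c''"
  have Mn: "M ^\<^sub>m n = e \<cdot>\<^sub>m 1\<^sub>m n"
    using carr(1) by (simp add: M_def e_def pow_mat_smult c''(2) smult_smult_mat del: One_nat_def)
  \<comment> \<open>Sandwiching \<open>T\<close> between two copies of \<open>M^n\<close> multiplies
    it by \<open>e * e\<close>, yet leaves it unchanged by \<open>pow_mat_sandwich\<close>. A
    further factor \<open>T\<close> turns this into an equation of scalar matrices, read off at one
    entry.\<close>
  have "T = (e * e) \<cdot>\<^sub>m T"
    using pow_mat_sandwich[OF MT MTM, of n] MT unfolding Mn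
    by (simp add: mult_smult_assoc_mat[of _ n n _ n] mult_smult_distrib[of _ n n _ n] smult_smult_mat)
  then have "T * T = (e * e) \<cdot>\<^sub>m (T * T)"
    using MT by (metis mult_smult_assoc_mat)
  then have "(1\<^sub>m n :: complex mat) $$ (0, 0) = ((e * e) \<cdot>\<^sub>m 1\<^sub>m n) $$ (0, 0)" unfolding TT by simp
  then have "e * e = 1" using n by simp
  then have "e = 1 \<or> e = -1" by (simp add: square_eq_1_iff)
  then obtain \<epsilon> :: real where eps: "e = of_real \<epsilon>" "\<epsilon> * \<epsilon> = 1"
    by (metis mult_1 of_real_1 of_real_minus square_eq_1_iff)
  have "normalized_dihedral_rep n M T \<epsilon>"
    using n M T Mn TT MTM eps by unfold_locales auto
  then show ?thesis using x y that unfolding M_def T_def by blast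
qed

text \<open>Conjugating \<open>\<rho>\<close> back along the equivalence gives a homomorphism whose
  values are phases times those of \<open>\<pi>\<close>. Its values at the generators serve as
  \<open>M\<close> and \<open>T\<close>, and \<open>M^n\<close> is exactly 1.\<close>

lemma normalize_strict_dihedral_rep:
  assumes strict: "strict_unitary_rep (dihedral_group n) n \<rho>"
    and equiv: "proj_equivalent (dihedral_group n) n \<pi> \<rho>"
    and rep: "proj_unitary_rep (dihedral_group n) n \<pi>" and n: "n \<ge> 2"
  obtains x y where "cmod x = 1" "cmod y = 1"
    "normalized_dihedral_rep n (x \<cdot>\<^sub>m \<pi> (1, False)) (y \<cdot>\<^sub>m \<pi> (0, True)) 1"
proof -
  obtain U where U: "unitary_mat n U"
    and UE: "\<And>g. g \<in> carrier (dihedral_group n) \<Longrightarrow> \<exists>c. cmod c = 1 \<and> \<rho> g = c \<cdot>\<^sub>m (U * \<pi> g * mat_adjoint U)"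
    using equiv unfolding proj_equivalent_def by blast
  let ?V = "mat_adjoint U"
  have cU: "U \<in> carrier_mat n n" "?V \<in> carrier_mat n n" and VU: "?V * U = 1\<^sub>m n" and UV: "U * ?V = 1\<^sub>m n"
    using U by (auto simp: unitary_mat_def mat_adjoint_carrier)
  have c\<rho>: "\<rho> (k, e) \<in> carrier_mat n n" and c\<pi>: "\<pi> (k, e) \<in> carrier_mat n n"
    and u\<rho>: "unitary_mat n (\<rho> (k, e))" if "k < n" for k e
    using strict that dihedral_rep_carrier[OF rep n]
    by (auto simp: strict_unitary_rep_def unitary_mat_carrier)
  have mult: "\<rho> (k, e) * \<rho> (l, f) = \<rho> ((k + (if e then n - l else l)) mod n, e \<noteq> f)" if "k < n" "l < n" for k e l f
    using strict that unfolding strict_unitary_rep_def by (metis carrier_dihedral mult_dihedral)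
  \<comment> \<open>Strictness asks for multiplicativity, from which the unit law follows: an
    idempotent unitary matrix is the identity.\<close>
  have one: "\<rho> (0, False) = 1\<^sub>m n"
  proof -
    let ?R = "\<rho> (0, False)"
    have R: "?R \<in> carrier_mat n n" "mat_adjoint ?R \<in> carrier_mat n n" "mat_adjoint ?R * ?R = 1\<^sub>m n" "?R * ?R = ?R"
      using u\<rho>[of 0 False] c\<rho>[of 0 False] mult[of 0 0 False False] n
      by (auto simp: unitary_mat_def mat_adjoint_carrier)
    then have "?R = mat_adjoint ?R * ?R * ?R" by simp
    also have "\<dots> = mat_adjoint ?R * (?R * ?R)" using R by (intro assoc_mult_mat) auto
    finally show ?thesis using R by simp
  qed
  define \<phi> where "\<phi> A = ?V * A * U" for A
  have \<phi>_mult: "\<phi> A * \<phi> B = \<phi> (A * B)" if "A \<in> carrier_mat n n" "B \<in> carrier_mat n n" for A B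
  proof -
    have "\<phi> A * \<phi> B = ?V * A * (U * ?V) * B * U"
      using that cU by (simp add: \<phi>_def assoc_mult_mat[of _ n n _ n _ n] mult_carrier_mat[of _ n n _ n] del: UV)
    also have "\<dots> = \<phi> (A * B)"
      using that cU by (simp add: UV \<phi>_def assoc_mult_mat[of _ n n _ n _ n] mult_carrier_mat[of _ n n _ n])
    finally show ?thesis .
  qed
  have \<phi>_one: "\<phi> (1\<^sub>m n) = 1\<^sub>m n" using cU VU by (simp add: \<phi>_def)
  have \<phi>_carrier: "\<phi> A \<in> carrier_mat n n" if "A \<in> carrier_mat n n" for A
    using that cU by (simp add: \<phi>_def mult_carrier_mat[of _ n n _ n])
  have \<phi>_unitary: "unitary_mat n (\<phi> A)" if "unitary_mat n A" for A
    using that U by (simp add: \<phi>_def unitary_mat_mult unitary_mat_adjoint)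
  have \<phi>\<rho>: "\<exists>c. cmod c = 1 \<and> \<phi> (\<rho> (k, e)) = c \<cdot>\<^sub>m \<pi> (k, e)" if k: "k < n" for k e
  proof -
    obtain c where c: "cmod c = 1" "\<rho> (k, e) = c \<cdot>\<^sub>m (U * \<pi> (k, e) * ?V)"
      using UE[of "(k, e)"] k by auto
    have "\<phi> (\<rho> (k, e)) = c \<cdot>\<^sub>m (?V * (U * \<pi> (k, e) * ?V) * U)"
      using cU c\<pi>[OF k, of e] by (simp add: c(2) \<phi>_def mult_smult_assoc_mat[of _ n n _ n]
        mult_smult_distrib[of _ n n _ n] mult_carrier_mat[of _ n n _ n])
    also have "?V * (U * \<pi> (k, e) * ?V) * U = (?V * U) * \<pi> (k, e) * (?V * U)"
      using cU c\<pi>[OF k, of e] by (simp add: assoc_mult_mat[of _ n n _ n _ n] mult_carrier_mat[of _ n n _ n])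
    also have "\<dots> = \<pi> (k, e)" using c\<pi>[OF k, of e] by (simp add: VU)
    finally show ?thesis using c(1) by blast
  qed
  obtain x y where x: "cmod x = 1" "\<phi> (\<rho> (1, False)) = x \<cdot>\<^sub>m \<pi> (1, False)"
    and y: "cmod y = 1" "\<phi> (\<rho> (0, True)) = y \<cdot>\<^sub>m \<pi> (0, True)"
    using \<phi>\<rho>[of 1 False] \<phi>\<rho>[of 0 True] n by auto
  have pow: "\<phi> (\<rho> (1, False)) ^\<^sub>m k = \<phi> (\<rho> (k mod n, False))" for k
  proof (induction k)
    case 0
    then show ?case using \<phi>_carrier[OF c\<rho>[of 1 False]] n by (simp add: one \<phi>_one)
  next
    case (Suc k)
    then show ?case using mult[of "k mod n" 1 False False] n c\<rho>
      by (simp add: \<phi>_mult mod_Suc_eq)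
  qed
  have "normalized_dihedral_rep n (\<phi> (\<rho> (1, False))) (\<phi> (\<rho> (0, True))) 1"
  proof
    show "\<phi> (\<rho> (1, False)) ^\<^sub>m n = complex_of_real 1 \<cdot>\<^sub>m 1\<^sub>m n"
      using pow[of n] by (simp add: one \<phi>_one)
    show "\<phi> (\<rho> (0, True)) * \<phi> (\<rho> (0, True)) = 1\<^sub>m n"
      using mult[of 0 0 True True] n c\<rho> by (simp add: \<phi>_mult one \<phi>_one)
    show "\<phi> (\<rho> (1, False)) * \<phi> (\<rho> (0, True)) * \<phi> (\<rho> (1, False)) = \<phi> (\<rho> (0, True))"
      using mult[of 1 0 False True] mult[of 1 1 True False] n c\<rho> by (simp add: \<phi>_mult)
  qed (use n u\<rho> in \<open>auto intro!: \<phi>_unitary\<close>)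
  then show ?thesis using x y that by simp
qed

section \<open>Switching by phases and determinants of bases\<close>

lemma sum_lessThan_add:
  "(\<Sum>i<m + n. f i) = (\<Sum>i<m. f i) + (\<Sum>i<n. f (m + i))"
  for f :: "nat \<Rightarrow> 'a :: comm_monoid_add"
  by (induction n) (auto simp: add.assoc)

lemma switching_equivalent_rescale:
  assumes G: "G \<in> carrier_mat m m" and B: "B \<in> carrier_mat m m"
    and c: "\<And>i. i < m \<Longrightarrow> cmod (c i) = 1"
    and entry: "\<And>i j. i < m \<Longrightarrow> j < m \<Longrightarrow> G $$ (i, j) = cnj (c i) * c j * B $$ (i, j)"
  shows "switching_equivalent m G B"
proof -
  \<comment> \<open>The monomial matrix is diagonal: conjugation by it multiplies the entry at
    \<open>(i, j)\<close> by \<open>c i * cnj (c j)\<close>, the inverse of the assumed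
    factor.\<close>
  define D where "D = mat m m (\<lambda>(i, j). if j = id i then c i else 0)"
  have D: "D \<in> carrier_mat m m" by (simp add: D_def)
  have "phase_monomial m D" unfolding phase_monomial_def D_def
    using c by (intro exI[of _ id] exI[of _ c]) (simp add: permutes_id)
  moreover have "D * G * mat_adjoint D = B"
  proof (rule eq_matI)
    fix i j assume "i < dim_row B" "j < dim_col B"
    then have ij: "i < m" "j < m" using B by auto
    have DG: "(D * G) $$ (i, k) = c i * G $$ (i, k)" if "k < m" for k
    proof -
      have "(D * G) $$ (i, k) = (\<Sum>l<m. (if l = i then c i else 0) * G $$ (l, k))"
        using ij that G by (simp add: D_def scalar_prod_def atLeast0LessThan)
      then show ?thesis using ij by (simp add: if_distrib[of "\<lambda>x. x * _"] cong: if_cong)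
    qed
    have "(D * G * mat_adjoint D) $$ (i, j) = (\<Sum>k<m. (D * G) $$ (i, k) * mat_adjoint D $$ (k, j))"
      using ij D G by (simp add: scalar_prod_def atLeast0LessThan)
    also have "\<dots> = (\<Sum>k<m. c i * G $$ (i, k) * (if k = j then cnj (c j) else 0))"
    proof (rule sum.cong[OF refl])
      fix k assume "k \<in> {..<m}"
      moreover from this have "mat_adjoint D $$ (k, j) = (if k = j then cnj (c j) else 0)"
        using ij by (simp add: mat_adjoint_index D_def)
      ultimately show "(D * G) $$ (i, k) * mat_adjoint D $$ (k, j)
          = c i * G $$ (i, k) * (if k = j then cnj (c j) else 0)" by (simp only: DG lessThan_iff)
    qed
    also have "\<dots> = (c i * cnj (c i)) * (c j * cnj (c j)) * B $$ (i, j)"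
      using ij by (simp add: entry if_distrib[of "\<lambda>x. _ * x"] mult_ac cong: if_cong)
    finally show "(D * G * mat_adjoint D) $$ (i, j) = B $$ (i, j)"
      using c[OF ij(1)] c[OF ij(2)] by (simp add: cmod_1_cnj)
  qed (use B D in auto)
  ultimately show ?thesis unfolding switching_equivalent_def by blast
qed

lemma basis_det_nonzero:
  fixes f :: "nat \<Rightarrow> complex vec"
  assumes inj: "inj_on f {0..<n}"
    and basis: "vectorspace.basis class_ring (module_vec TYPE(complex) n) (f ` {0..<n})"
  shows "det (mat_of_cols n (map f [0..<n])) \<noteq> 0"
proof -
  interpret vec_space "TYPE(complex)" n .
  let ?A = "mat_of_cols n (map f [0..<n])"
  have A: "?A \<in> carrier_mat n n" by (metis length_map length_upt mat_of_cols_carrier(1) minus_nat.diff_0)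
  have li: "lin_indpt (f ` {0..<n})" and sub: "f ` {0..<n} \<subseteq> carrier_vec n"
    using basis unfolding basis_def by auto
  have cols: "cols ?A = map f [0..<n]" using sub by (intro cols_mat_of_cols) auto
  have "rank ?A = n"
    using A li inj by (intro lin_indpt_full_rank) (auto simp: cols distinct_map)
  then show ?thesis using det_rank_iff[OF A] by simp
qed

text \<open>Explicit phases \<open>x\<close> and \<open>y\<close> tie \<open>M\<close> and
  \<open>T\<close> to \<open>\<pi>\<close>, so that the columns of the configuration can be compared
  with \<open>u\<close> and \<open>w\<close>. The locale serves any normalization, including one
  obtained from a strict representation.\<close>

locale normalized_configuration = normalized_dihedral_orbit +
  fixes \<pi> :: "nat \<times> bool \<Rightarrow> complex mat" and x y :: complex
  assumes rep: "proj_unitary_rep (dihedral_group n) n \<pi>" and n_ge_2: "n \<ge> 2"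
    and x: "cmod x = 1" and y: "cmod y = 1"
    and M_eq: "M = x \<cdot>\<^sub>m \<pi> (1, False)" and T_eq: "T = y \<cdot>\<^sub>m \<pi> (0, True)"
begin

lemma rotation_phase:
  assumes "k < n"
  obtains c where "cmod c = 1" "\<pi> (k, False) = c \<cdot>\<^sub>m Mz (int k)"
proof -
  have carr: "\<pi> (1, False) \<in> carrier_mat n n" using dihedral_rep_carrier[OF rep n_ge_2] n_ge_2 by simp
  obtain c where c: "cmod c = 1" "\<pi> (1, False) ^\<^sub>m k = c \<cdot>\<^sub>m \<pi> (k, False)"
    using dihedral_rep_pow[OF rep n_ge_2, of k] assms by auto
  have "M ^\<^sub>m k = x ^ k \<cdot>\<^sub>m (c \<cdot>\<^sub>m \<pi> (k, False))"
    using pow_mat_smult[OF carr, of x k] unfolding c(2) M_eq .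
  then have "(cnj c * cnj x ^ k) \<cdot>\<^sub>m Mz (int k) = (cnj c * (cnj x * x) ^ k * c) \<cdot>\<^sub>m \<pi> (k, False)"
    unfolding Mz_int by (simp add: smult_smult_mat power_mult_distrib mult_ac)
  then have "\<pi> (k, False) = (cnj c * cnj x ^ k) \<cdot>\<^sub>m Mz (int k)"
    using cmod_1_cnj[OF c(1)] cmod_1_cnj[OF x] by simp
  then show ?thesis using c(1) x by (intro that[of "cnj c * cnj x ^ k"]) (auto simp: norm_mult norm_power)
qed

lemma reflection_phase:
  assumes "k < n"
  obtains c where "cmod c = 1" "\<pi> (k, True) = c \<cdot>\<^sub>m (Mz (int k) * T)"
proof -
  have carr: "\<pi> (k, True) \<in> carrier_mat n n" "\<pi> (0, True) \<in> carrier_mat n n"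
    using dihedral_rep_carrier[OF rep n_ge_2] assms n_ge_2 by auto
  obtain c where c: "cmod c = 1" "\<pi> (k, False) * \<pi> (0, True) = c \<cdot>\<^sub>m \<pi> (k, True)"
    using proj_rep_mult[OF rep, of "(k, False)" "(0, True)"] assms by auto
  obtain c' where c': "cmod c' = 1" "\<pi> (k, False) = c' \<cdot>\<^sub>m Mz (int k)"
    using rotation_phase[OF assms] .
  have "(cnj c * cnj y * c') \<cdot>\<^sub>m (Mz (int k) * T) = (cnj c * cnj y * y) \<cdot>\<^sub>m (\<pi> (k, False) * \<pi> (0, True))"
    using carr by (simp add: c'(2) T_eq mult_smult_distrib[of _ n n _ n] mult_smult_assoc_mat[of _ n n _ n]
      smult_smult_mat mult_ac)
  also have "\<dots> = (cnj c * c * (cnj y * y)) \<cdot>\<^sub>m \<pi> (k, True)"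
    by (simp add: c(2) smult_smult_mat mult_ac)
  finally have "\<pi> (k, True) = (cnj c * cnj y * c') \<cdot>\<^sub>m (Mz (int k) * T)"
    using cmod_1_cnj[OF c(1)] cmod_1_cnj[OF y] by simp
  then show ?thesis using c(1) c'(1) y by (intro that[of "cnj c * cnj y * c'"]) (auto simp: norm_mult)
qed

abbreviation "\<Phi> \<equiv> dihedral_frame_mat n \<pi> v"

definition \<psi> :: "nat \<Rightarrow> complex vec" where
  "\<psi> i = (if i < n then u (int i) else w (int (i - n)))"

lemma \<psi>_carrier [simp]: "\<psi> i \<in> carrier_vec n"
  by (simp add: \<psi>_def)

lemma \<Phi>_carrier: "\<Phi> \<in> carrier_mat n (2 * n)"
  unfolding dihedral_frame_mat_def by (rule carrier_matI) auto

lemma \<Phi>_col_rotation: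
  assumes "i < n"
  shows "col \<Phi> i = \<pi> (i, False) *\<^sub>v v"
proof -
  have "\<pi> (i, False) *\<^sub>v v \<in> carrier_vec n"
    using dihedral_rep_carrier[OF rep n_ge_2 assms] v_carrier by (rule mult_mat_vec_carrier)
  then show ?thesis
    using assms unfolding dihedral_frame_mat_def by (subst col_mat_of_cols) (auto simp: nth_append)
qed

lemma \<Phi>_col_reflection:
  assumes "n \<le> i" "i < 2 * n"
  shows "col \<Phi> i = \<pi> (i - n, True) *\<^sub>v v"
proof -
  have "i - n < n" using assms by simp
  then have "\<pi> (i - n, True) *\<^sub>v v \<in> carrier_vec n"
    using dihedral_rep_carrier[OF rep n_ge_2] v_carrier by (intro mult_mat_vec_carrier[of _ n n])
  then show ?thesis
    using assms unfolding dihedral_frame_mat_def by (subst col_mat_of_cols) (auto simp: nth_append)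
qed

lemma \<Phi>_col_phase:
  assumes "i < 2 * n"
  shows "\<exists>c. cmod c = 1 \<and> col \<Phi> i = c \<cdot>\<^sub>v \<psi> i"
proof (cases "i < n")
  case True
  obtain c where "cmod c = 1" "\<pi> (i, False) = c \<cdot>\<^sub>m Mz (int i)" using rotation_phase[OF True] .
  then show ?thesis using True
    by (intro exI[of _ c]) (auto simp: \<Phi>_col_rotation \<psi>_def u_def smult_mat_mult_vec[of _ n n])
next
  case False
  then have "i - n < n" using assms by simp
  then obtain c where "cmod c = 1" "\<pi> (i - n, True) = c \<cdot>\<^sub>m (Mz (int (i - n)) * T)"
    using reflection_phase by blast
  then show ?thesis using False assms
    by (intro exI[of _ c]) (auto simp: \<Phi>_col_reflection \<psi>_def w_def smult_mat_mult_vec[of _ n n]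
      mult_carrier_mat[of _ n n] assoc_mult_mat_vec[of _ n n _ n])
qed

lemma \<Phi>_col_phases:
  obtains d where "\<And>i. i < 2 * n \<Longrightarrow> cmod (d i) = 1" "\<And>i. i < 2 * n \<Longrightarrow> col \<Phi> i = d i \<cdot>\<^sub>v \<psi> i"
  using \<Phi>_col_phase by metis

text \<open>The switching phases are those relating the columns of \<open>\<Phi>\<close> to
  \<open>\<psi>\<close>. The Gram entry at \<open>(i, j)\<close> is the inner product of column
  \<open>j\<close> with column \<open>i\<close>, whence the offset \<open>j - i\<close> in the upper
  left block and, by \<open>w_w\<close>, \<open>i - j\<close> in the lower right one.\<close>

lemma gram_switching:
  "switching_equivalent (2 * n) (mat_adjoint \<Phi> * \<Phi>)
    (mat (2 * n) (2 * n) (\<lambda>(i, j).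
       if i < n then if j < n then a (int j - int i) else b (int (j - n) - int i)
       else if j < n then b (int (i - n) - int j) else a (int i - int j)))"
proof -
  obtain d where d: "\<And>i. i < 2 * n \<Longrightarrow> cmod (d i) = 1" "\<And>i. i < 2 * n \<Longrightarrow> col \<Phi> i = d i \<cdot>\<^sub>v \<psi> i"
    using \<Phi>_col_phases by blast
  show ?thesis
  proof (rule switching_equivalent_rescale[of _ _ _ d])
    show "mat_adjoint \<Phi> * \<Phi> \<in> carrier_mat (2 * n) (2 * n)"
      using \<Phi>_carrier by (auto simp: mat_adjoint_carrier)
    fix i j assume ij: "i < 2 * n" "j < 2 * n"
    have "(mat_adjoint \<Phi> * \<Phi>) $$ (i, j) = cnj (d i) * d j * (\<psi> j \<bullet>c \<psi> i)"
      unfolding gram_index[OF \<Phi>_carrier ij] d(2)[OF ij(1)] d(2)[OF ij(2)]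
      by (simp add: cscalar_prod_smult_left[where n = n] cscalar_prod_smult_right[where n = n] mult_ac)
    then show "(mat_adjoint \<Phi> * \<Phi>) $$ (i, j) = cnj (d i) * d j *
      mat (2 * n) (2 * n) (\<lambda>(i, j).
       if i < n then if j < n then a (int j - int i) else b (int (j - n) - int i)
       else if j < n then b (int (i - n) - int j) else a (int i - int j)) $$ (i, j)"
      using ij by (simp add: \<psi>_def u_u u_w w_u w_w of_nat_diff)
  qed (use d in auto)
qed

lemma regular_det:
  assumes "regular_dihedral n \<pi> v"
  shows "det (mat n n (\<lambda>(i, k). u (int k) $ i)) \<noteq> 0"
proof -
  define f where "f k = (if k = 0 then v else \<pi> (dih_mu n [^]\<^bsub>dihedral_group n\<^esub> k) *\<^sub>v v)" for k :: nat
  have "\<exists>c. cmod c = 1 \<and> u (int k) = c \<cdot>\<^sub>v f k" if k: "k < n" for k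
  proof (cases "k = 0")
    case True
    then show ?thesis by (intro exI[of _ 1]) (simp add: f_def u_0)
  next
    case False
    obtain c where c: "cmod c = 1" "\<pi> (k, False) = c \<cdot>\<^sub>m Mz (int k)" using rotation_phase[OF k] .
    have "f k = c \<cdot>\<^sub>v u (int k)"
      using False k by (simp add: f_def dih_mu_pow c(2) u_def smult_mat_mult_vec[of _ n n])
    then show ?thesis using cmod_1_cnj[OF c(1)] c(1)
      by (intro exI[of _ "cnj c"]) (simp add: smult_smult_assoc)
  qed
  then obtain d where d: "\<And>k. k < n \<Longrightarrow> cmod (d k) = 1" "\<And>k. k < n \<Longrightarrow> u (int k) = d k \<cdot>\<^sub>v f k"
    by metis
  have fc: "f k \<in> carrier_vec n" if "k < n" for k
    using that dihedral_rep_carrier[OF rep n_ge_2, of k False]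
    by (auto simp: f_def dih_mu_pow mult_mat_vec_carrier)
  let ?B = "mat_of_cols n (map f [0..<n])"
  define A where "A = mat n n (\<lambda>(i, k). u (int k) $ i)"
  have "det ?B \<noteq> 0"
    using assms unfolding regular_dihedral_def f_def Let_def by (intro basis_det_nonzero) auto
  moreover have B: "?B \<in> carrier_mat n n" by (rule carrier_matI) auto
  moreover have A: "A \<in> carrier_mat n n" by (simp add: A_def)
  have "z = 0\<^sub>v n" if z: "z \<in> carrier_vec n" and Az: "A *\<^sub>v z = 0\<^sub>v n" for z
  proof -
    \<comment> \<open>Rescaling columns by the phases \<open>d k\<close> is moved over to the
      vector, so a kernel vector of \<open>A\<close> yields one of the basis matrix; nonzero phases
      let it be traced back to \<open>z = 0\<close>.\<close>
    have "?B *\<^sub>v vec n (\<lambda>k. d k * z $ k) = A *\<^sub>v z"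
      using z carrier_vecD[OF fc] d(2) by (intro eq_vecI) (auto simp: A_def scalar_prod_def mat_of_cols_index intro!: sum.cong)
    then have "vec n (\<lambda>k. d k * z $ k) = 0\<^sub>v n"
      using \<open>det ?B \<noteq> 0\<close> det_0_iff_vec_prod_zero[OF B] Az by (metis vec_carrier)
    then have "d k * z $ k = 0" if "k < n" for k
      using that by (metis index_vec index_zero_vec(1))
    moreover have "d k \<noteq> 0" if "k < n" for k using d(1)[OF that] by auto
    ultimately show ?thesis using z by (intro eq_vecI) auto
  qed
  then show ?thesis using det_0_iff_vec_prod_zero[OF A] unfolding A_def by blast
qed

text \<open>Phases cancel in the frame products and in the moduli, so \<open>\<psi>\<close> inherits
  these properties from \<open>\<Phi>\<close>. It remains to determine the frame constant, by the
  trace, and the common modulus.\<close>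

lemma regular_dihedral_etf:
  assumes unit: "v \<bullet>c v = 1" and regular: "regular_dihedral n \<pi> v" and etf: "etf (2 * n) n \<Phi>"
  shows "regular_dihedral_etf n M T \<epsilon> v"
proof -
  obtain A \<alpha> where
    frame: "\<And>x. x \<in> carrier_vec n \<Longrightarrow> (\<Sum>i<2 * n. (cmod (x \<bullet>c col \<Phi> i))\<^sup>2) = A * Re (x \<bullet>c x)"
    and norm: "\<And>i. i < 2 * n \<Longrightarrow> col \<Phi> i \<bullet>c col \<Phi> i = 1"
    and angle: "\<And>i j. i < 2 * n \<Longrightarrow> j < 2 * n \<Longrightarrow> i \<noteq> j \<Longrightarrow> cmod (col \<Phi> i \<bullet>c col \<Phi> j) = \<alpha>"
    using etf unfolding etf_def tight_frame_def by blast
  have "A * real n = real (2 * n)"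
    by (rule tight_frame_constant[OF \<Phi>_carrier frame norm])
  then have A: "A = 2" using n_pos by simp
  obtain d where d: "\<And>i. i < 2 * n \<Longrightarrow> cmod (d i) = 1" "\<And>i. i < 2 * n \<Longrightarrow> col \<Phi> i = d i \<cdot>\<^sub>v \<psi> i"
    using \<Phi>_col_phases by blast
  have frame': "(\<Sum>i<2 * n. (p \<bullet>c \<psi> i) * (\<psi> i \<bullet>c q)) = 2 * (p \<bullet>c q)"
    if pq: "p \<in> carrier_vec n" "q \<in> carrier_vec n" for p q
  proof -
    have "(p \<bullet>c col \<Phi> i) * (col \<Phi> i \<bullet>c q) = (p \<bullet>c \<psi> i) * (\<psi> i \<bullet>c q)" if i: "i < 2 * n" for i
    proof -
      have "(p \<bullet>c col \<Phi> i) * (col \<Phi> i \<bullet>c q) = (cnj (d i) * d i) * ((p \<bullet>c \<psi> i) * (\<psi> i \<bullet>c q))"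
        unfolding d(2)[OF i] using pq
        by (simp add: cscalar_prod_smult_left[where n = n] cscalar_prod_smult_right[where n = n] mult_ac)
      then show ?thesis by (simp add: cmod_1_cnj d(1)[OF i])
    qed
    then show ?thesis using tight_frame_polarized[OF \<Phi>_carrier frame pq] A by simp
  qed
  have angle': "cmod (\<psi> i \<bullet>c \<psi> j) = \<alpha>" if ij: "i < 2 * n" "j < 2 * n" "i \<noteq> j" for i j
    using angle[OF ij] d(1)[OF ij(1)] d(1)[OF ij(2)] unfolding d(2)[OF ij(1)] d(2)[OF ij(2)]
    by (simp add: cscalar_prod_smult_left[where n = n] cscalar_prod_smult_right[where n = n] norm_mult)
  have "\<alpha> = cmod (\<psi> 0 \<bullet>c \<psi> 1)" using angle'[of 0 1] n_pos by simp
  then have alpha_nonneg: "\<alpha> \<ge> 0" by simp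
  have \<psi>0: "\<psi> 0 = v" using n_pos by (simp add: \<psi>_def u_0)
  \<comment> \<open>The frame identity at \<open>v\<close> itself has one summand 1 and
    \<open>2n - 1\<close> summands \<open>\<alpha>^2\<close>, which puts \<open>\<alpha>\<close> at
    the Welch bound.\<close>
  have "2 = (\<Sum>i<2 * n. (cmod (v \<bullet>c \<psi> i))\<^sup>2)"
  proof -
    have "(v \<bullet>c \<psi> i) * (\<psi> i \<bullet>c v) = of_real ((cmod (v \<bullet>c \<psi> i))\<^sup>2)" for i
      using cscalar_prod_cnj[of v n "\<psi> i"] by (simp only: complex_norm_square) simp
    then have "complex_of_real (\<Sum>i<2 * n. (cmod (v \<bullet>c \<psi> i))\<^sup>2) = of_real 2"
      using frame'[of v v] unit by simp
    then show ?thesis by (simp only: of_real_eq_iff)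
  qed
  also have "\<dots> = (\<Sum>i<2 * n. if i = 0 then 1 else \<alpha>\<^sup>2)"
    using angle'[of 0] n_pos unit by (intro sum.cong) (auto simp: \<psi>0)
  also have "\<dots> = 1 + (2 * real n - 1) * \<alpha>\<^sup>2"
  proof -
    obtain m where m: "2 * n = Suc m" using n_pos by (cases "2 * n") auto
    then have "real m = 2 * real n - 1" by linarith
    then show ?thesis unfolding m by (subst sum.lessThan_Suc_shift) simp
  qed
  finally have "\<alpha>\<^sup>2 = 1 / (2 * real n - 1)" using n_ge_2 by (simp add: field_simps)
  then have alpha: "\<alpha> = 1 / sqrt (2 * real n - 1)"
    using alpha_nonneg by (metis real_sqrt_abs abs_of_nonneg real_sqrt_divide real_sqrt_one)
  show ?thesis
  proof
    fix p q :: "complex vec" assume "p \<in> carrier_vec n" "q \<in> carrier_vec n"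
    then show "(\<Sum>k<n. (p \<bullet>c u (int k)) * (u (int k) \<bullet>c q)) + (\<Sum>k<n. (p \<bullet>c w (int k)) * (w (int k) \<bullet>c q))
      = 2 * (p \<bullet>c q)"
      using frame'[of p q] unfolding mult_2 sum_lessThan_add by (simp add: \<psi>_def)
  next
    fix l assume l: "0 < l" "l < int n"
    then obtain k where k: "l = int k" "0 < k" "k < n"
      by (metis nat_0_le less_imp_le nat_less_iff zero_less_nat_eq)
    then show "cmod (a l) = 1 / sqrt (2 * real n - 1)"
      using angle'[of k 0] n_pos by (simp add: \<psi>_def u_u alpha)
  next
    fix l assume l: "0 \<le> l" "l < int n"
    then obtain k where k: "l = int k" "k < n"
      by (metis nat_0_le nat_less_iff)
    then show "cmod (b l) = 1 / sqrt (2 * real n - 1)"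
      using angle'[of "n + k" 0] n_pos by (simp add: \<psi>_def w_u alpha)
  qed (use n_ge_2 unit regular_det[OF regular] in auto)
qed

end

theorem theorem4p24:
  fixes n :: nat and \<pi> :: "nat \<times> bool \<Rightarrow> complex mat" and v :: "complex vec"
    and \<Phi> :: "complex mat"
  assumes "n \<ge> 2"
    and "dihedral_configuration n \<pi> v"
    and "regular_dihedral n \<pi> v"
    and "\<Phi> = dihedral_frame_mat n \<pi> v"
    and "etf (2 * n) n \<Phi>"
  shows "genuine_projective (dihedral_group n) n \<pi> \<and>
    (\<exists>H P Q. negacirculant n P \<and> negacirculant n Q \<and>
       H = four_block_mat P Q (- transpose_mat Q) (transpose_mat P) \<and>
       skew_hadamard (2 * n) H \<and>
       switching_equivalent (2 * n) (mat_adjoint \<Phi> * \<Phi>)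
         (1\<^sub>m (2 * n) + complex_of_real (1 / sqrt (2 * real n - 1)) \<cdot>\<^sub>m
            four_block_mat
              (\<i> \<cdot>\<^sub>m map_mat complex_of_real (P - 1\<^sub>m n)) (map_mat complex_of_real Q)
              (map_mat complex_of_real (transpose_mat Q))
              (\<i> \<cdot>\<^sub>m map_mat complex_of_real (- P + 1\<^sub>m n))))"
proof (rule conjI)
  have rep: "proj_unitary_rep (dihedral_group n) n \<pi>" and v: "v \<in> carrier_vec n" "v \<bullet>c v = 1"
    using assms(2) by (auto simp: dihedral_configuration_def)
  have config: "normalized_configuration n (x \<cdot>\<^sub>m \<pi> (1, False)) (y \<cdot>\<^sub>m \<pi> (0, True)) \<epsilon> v \<pi> x y"
    if "cmod x = 1" "cmod y = 1"
      "normalized_dihedral_rep n (x \<cdot>\<^sub>m \<pi> (1, False)) (y \<cdot>\<^sub>m \<pi> (0, True)) \<epsilon>" for x y \<epsilon>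
    using that rep v assms(1)
    by (simp add: normalized_configuration_def normalized_configuration_axioms_def
        normalized_dihedral_orbit_def normalized_dihedral_orbit_axioms_def)
  show "genuine_projective (dihedral_group n) n \<pi>"
    unfolding genuine_projective_def
  proof (intro conjI notI rep)
    \<comment> \<open>A strict representation would provide a normalization of the same
      configuration with \<open>\<epsilon> = 1\<close>, while \<open>eps_eq\<close> gives -1 for
      every normalization.\<close>
    assume "\<exists>\<rho>. strict_unitary_rep (dihedral_group n) n \<rho> \<and> proj_equivalent (dihedral_group n) n \<pi> \<rho>"
    then obtain \<rho> where \<rho>: "strict_unitary_rep (dihedral_group n) n \<rho>" "proj_equivalent (dihedral_group n) n \<pi> \<rho>"
      by blast
    obtain x y where xy: "cmod x = 1" "cmod y = 1"
      "normalized_dihedral_rep n (x \<cdot>\<^sub>m \<pi> (1, False)) (y \<cdot>\<^sub>m \<pi> (0, True)) 1"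
      by (rule normalize_strict_dihedral_rep[OF \<rho> rep assms(1)])
    interpret normalized_configuration n "x \<cdot>\<^sub>m \<pi> (1, False)" "y \<cdot>\<^sub>m \<pi> (0, True)" 1 v \<pi> x y
      by (rule config[OF xy])
    interpret E: regular_dihedral_etf n "x \<cdot>\<^sub>m \<pi> (1, False)" "y \<cdot>\<^sub>m \<pi> (0, True)" 1 v
      using regular_dihedral_etf v assms(3,5) unfolding assms(4) by blast
    show False using E.eps_eq by simp
  qed
  \<comment> \<open>Now \<open>\<pi>\<close> itself is normalized; the sign turns out to be -1,
    which makes \<open>P\<close> and \<open>Q\<close> negacirculant.\<close>
  obtain x y \<epsilon> where xy: "cmod x = 1" "cmod y = 1"
    "normalized_dihedral_rep n (x \<cdot>\<^sub>m \<pi> (1, False)) (y \<cdot>\<^sub>m \<pi> (0, True)) \<epsilon>"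
    by (rule normalize_dihedral_rep[OF rep assms(1)])
  interpret normalized_configuration n "x \<cdot>\<^sub>m \<pi> (1, False)" "y \<cdot>\<^sub>m \<pi> (0, True)" \<epsilon> v \<pi> x y
    by (rule config[OF xy])
  interpret E: regular_dihedral_etf n "x \<cdot>\<^sub>m \<pi> (1, False)" "y \<cdot>\<^sub>m \<pi> (0, True)" \<epsilon> v
    using regular_dihedral_etf v assms(3,5) unfolding assms(4) by blast
  show "\<exists>H P Q. negacirculant n P \<and> negacirculant n Q \<and>
       H = four_block_mat P Q (- transpose_mat Q) (transpose_mat P) \<and>
       skew_hadamard (2 * n) H \<and>
       switching_equivalent (2 * n) (mat_adjoint \<Phi> * \<Phi>)
         (1\<^sub>m (2 * n) + complex_of_real (1 / sqrt (2 * real n - 1)) \<cdot>\<^sub>m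
            four_block_mat
              (\<i> \<cdot>\<^sub>m map_mat complex_of_real (P - 1\<^sub>m n)) (map_mat complex_of_real Q)
              (map_mat complex_of_real (transpose_mat Q))
              (\<i> \<cdot>\<^sub>m map_mat complex_of_real (- P + 1\<^sub>m n)))"
    using E.negacirculant_PQ E.H_def E.skew_hadamard_H gram_switching
    unfolding E.displayed_matrix[symmetric] assms(4) by blast
qed

end
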